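(* Let $\gamma_1,\gamma_2,\beta_1,\beta_2,\beta_3$ be real constants with $\gamma_1\notin\{0,-1\}$, $\beta_1,\beta_2,\beta_3>0$, $\gamma_2\neq0$, and consider the control system with states $(x,y,\theta,u,v,r)$ and inputs $(u_1,u_2)$ $$\dot x=u\cos\theta-v\sin\theta,\quad \dot y=u\sin\theta+v\cos\theta,\quad \dot\theta=r,$$ $$\dot u=\tfrac{1}{\gamma_1}vr-\beta_1u+u_1,\quad \dot v=-\gamma_1ur-\beta_2v,\quad \dot r=\gamma_2uv-\beta_3r+u_2.$$ Put $\bar u_2=u_2+\gamma_2uv-\beta_3r$ and consider the prolonged system obtained by differentiating $\bar u_2$ four times, that is, the system with states $(x,y,\theta,u,v,r,\bar u_2,\bar u_{21},\bar u_{22},\bar u_{23})$, inputs $(u_1,\bar u_{24})$, and equations $$\dot x=u\cos\theta-v\sin\theta,\quad \dot y=u\sin\theta+v\cos\theta,\quad \dot\theta=r,\quad \dot u=\tfrac{1}{\gamma_1}vr-\beta_1u+u_1,\quad \dot v=-\gamma_1ur-\beta_2v,$$ $$\dot r=\bar u_2,\quad \dot{\bar u}_2=\bar u_{21},\quad \dot{\bar u}_{21}=\bar u_{22},\quad \dot{\bar u}_{22}=\bar u_{23},\quad \dot{\bar u}_{23}=\bar u_{24}.$$ With $z=x+\mathrm{i}y$, define $$y^1=rv+\frac{\gamma_1}{1+\gamma_1}\Big((1+\gamma_1)\,r^2\,\Re\big(ze^{-\mathrm{i}\theta}\big)+(\beta_2r+\bar u_2)\,\Im\big(ze^{-\mathrm{i}\theta}\big)\Big),\qquad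 y^2=\theta .$$ Then the prolonged system is static feedback linearizable with $y^1$ generating a chain of order $4$ and $y^2$ a chain of order $6$: the map sending $$(t,x,y,\theta,u,v,r,\bar u_2,\bar u_{21},\bar u_{22},\bar u_{23},u_1,\bar u_{24})$$ to $$\Big(t,\ y^1,\dot y^1,\dots,(y^1)^{(4)},\ y^2,\dot y^2,\dots,(y^2)^{(6)}\Big)$$ (time derivatives taken along the prolonged system) has Jacobian determinant equal, up to a sign depending only on the ordering of coordinates, to $$\Delta=\frac{\gamma_1^4}{(1+\gamma_1)^5}\Big((1+\gamma_1)^2r^4-(1+2\gamma_1)\bar u_2^2+(1+\gamma_1)r\bar u_{21}+\beta_2\big(\beta_2r^2+(1-\gamma_1)r\bar u_2\big)\Big)^4,$$ and is a static feedback transformation of the prolonged system to Brunovsky normal form locally wherever $\Delta\neq0$. In particular, $[y^1,y^2]$ is a flat output of the original control system (where $\Delta\ne0$).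
   Context: A control system $\dot x=f(t,x,u)$, $u\in\mathbb{R}^m$, is *flat* (locally, on a suitable open set) if there is an $\mathbb{R}^m$-valued function $Y$ of the states, inputs and finitely many derivatives of the inputs such that along trajectories all states and inputs can be expressed as functions of $Y$ and finitely many of its time derivatives: $x=\xi(Y,\dot Y,\dots,Y^{(p)})$, $u=\eta(Y,\dot Y,\dots,Y^{(q)})$. Such $Y$ is a *flat output*, and the formulas for $x,u$ are a *flat parametrization*. A system is *static feedback linearizable* (locally) if a change of coordinates $(t,x,u)\mapsto(t,\bar x(t,x),\bar u(t,x,u))$, a local diffeomorphism, takes it to a Brunovsky normal form: decoupled chains $\dot z_0=z_1,\dots,\dot z_{j-1}=z_j$ with $z_0,\dots,z_{j-1}$ states and $z_j$ an input; $j$ is the order of the chain. *)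

theory Defs
  imports "HOL-Analysis.Analysis" "HOL-Analysis.Finite_Function_Topology"
begin

section \<open>Smooth maps\<close>

primrec Ck_on :: "nat \<Rightarrow> 'a::real_normed_vector set \<Rightarrow> ('a \<Rightarrow> 'b::real_normed_vector) \<Rightarrow> bool" where
  "Ck_on 0 S f \<longleftrightarrow> continuous_on S f"
| "Ck_on (Suc k) S f \<longleftrightarrow>
     (\<forall>x\<in>S. f differentiable (at x)) \<and> (\<forall>v. Ck_on k S (\<lambda>x. frechet_derivative f (at x) v))"

text \<open>Only used for open \<open>S\<close>.\<close>

definition smooth_on :: "'a::real_normed_vector set \<Rightarrow> ('a \<Rightarrow> 'b::real_normed_vector) \<Rightarrow> bool" where
  "smooth_on S f \<longleftrightarrow> (\<forall>k. Ck_on k S f)"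


section \<open>Control systems, jets and total derivatives\<close>

type_synonym ('n, 'm) system = "real \<Rightarrow> real^'n \<Rightarrow> real^'m \<Rightarrow> real^'n"

text \<open>
  A jet \<open>(t, x, U)\<close> consists of time, state, and the input together with its derivatives,
  \<open>lookup U k\<close> standing for the \<open>k\<close>-th derivative of the input. Finitely supported sequences
  form a normed space that contains the jets of every finite order. On functions depending on
  finitely many entries, differentiability and smoothness there are the usual ones.
\<close>

type_synonym ('n, 'm) jet = "real \<times> (real^'n) \<times> (nat \<Rightarrow>\<^sub>0 real^'m)"

text \<open>
  Time derivative along the system: \<open>\<partial>\<^sub>t + f \<partial>\<^sub>x + \<Sum>\<^sub>k u\<^sup>k\<^sup>+\<^sup>1 \<partial>\<close> with respect to the
  \<open>k\<close>-th derivative \<open>u\<^sup>k\<close> of the input; \<open>map_key Suc\<close> shifts the sequence of input derivatives.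
\<close>

definition total_deriv ::
  "('n::finite, 'm::finite) system \<Rightarrow> (('n, 'm) jet \<Rightarrow> 'b::real_normed_vector) \<Rightarrow> ('n, 'm) jet \<Rightarrow> 'b" where
  "total_deriv f F = (\<lambda>(t, x, U).
     frechet_derivative F (at (t, x, U))
       (1, f t x (Poly_Mapping.lookup U 0), Poly_Mapping.map_key Suc U))"


section \<open>Static feedback linearization\<close>

text \<open>
  Brunovsky normal form with one chain for each input \<open>c\<close>, of order \<open>\<kappa> c\<close>: the labelling \<open>\<sigma>\<close>
  says which coordinate of the state vector is the \<open>k\<close>-th variable of the chain \<open>c\<close>, and the last
  variable of the chain is the input \<open>w $ c\<close>.
\<close>

definition brunovsky ::
  "('m::finite \<Rightarrow> nat) \<Rightarrow> ('m \<times> nat \<Rightarrow> 'n::finite) \<Rightarrow> ('n, 'm) system \<Rightarrow> bool" where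
  "brunovsky \<kappa> \<sigma> g \<longleftrightarrow>
     bij_betw \<sigma> {(c, k). k < \<kappa> c} UNIV \<and>
     (\<forall>t z w c k. k < \<kappa> c \<longrightarrow>
        g t z w $ \<sigma> (c, k) = (if Suc k < \<kappa> c then z $ \<sigma> (c, Suc k) else w $ c))"

text \<open>
  \<open>(t, x, u) \<mapsto> (t, z t x, w t x u)\<close> is a diffeomorphism from the open set \<open>N\<close> onto an open set
  and takes the system \<open>f\<close> to the system \<open>g\<close>.
\<close>

definition static_feedback_on ::
  "(real \<times> (real^'n) \<times> (real^'m)) set \<Rightarrow> ('n::finite, 'm::finite) system \<Rightarrow> ('n, 'm) system \<Rightarrow>
   (real \<Rightarrow> real^'n \<Rightarrow> real^'n) \<Rightarrow> (real \<Rightarrow> real^'n \<Rightarrow> real^'m \<Rightarrow> real^'m) \<Rightarrow> bool" where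
  "static_feedback_on N f g z w \<longleftrightarrow>
     (let \<Psi> = (\<lambda>(t, x, u). (t, z t x, w t x u)) in
        open N \<and> smooth_on N \<Psi> \<and> inj_on \<Psi> N \<and>
        open (\<Psi> ` N) \<and> smooth_on (\<Psi> ` N) (inv_into N \<Psi>)) \<and>
     (\<forall>(t, x, u)\<in>N.
        frechet_derivative (\<lambda>(t, x). z t x) (at (t, x)) (1, f t x u) = g t (z t x) (w t x u))"

definition static_feedback_linearizable_at ::
  "('n::finite, 'm::finite) system \<Rightarrow> real \<times> (real^'n) \<times> (real^'m) \<Rightarrow> bool" where
  "static_feedback_linearizable_at f p \<longleftrightarrow>
     (\<exists>N \<kappa> \<sigma> g z w. p \<in> N \<and> brunovsky \<kappa> \<sigma> g \<and> static_feedback_on N f g z w)"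

text \<open>
  The components of \<open>Y\<close> and their time derivatives along the system are the coordinates of a
  static feedback transformation on \<open>N\<close> to Brunovsky normal form, \<open>Y $ c\<close> generating a chain of
  order \<open>\<kappa> c\<close>. In particular the first \<open>\<kappa> c - 1\<close> derivatives of \<open>Y $ c\<close> are functions of
  \<open>(t, x)\<close>, and the next one is a function of \<open>(t, x, u)\<close>.
\<close>

definition generates_chains_on ::
  "(real \<times> (real^'n) \<times> (real^'m)) set \<Rightarrow> ('n::finite, 'm::finite) system \<Rightarrow>
   (('n, 'm) jet \<Rightarrow> real^'m) \<Rightarrow> ('m \<Rightarrow> nat) \<Rightarrow> bool" where
  "generates_chains_on N f Y \<kappa> \<longleftrightarrow>
     (\<exists>\<sigma> g z w. brunovsky \<kappa> \<sigma> g \<and> static_feedback_on N f g z w \<and>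
        (\<forall>t x U c. (t, x, Poly_Mapping.lookup U 0) \<in> N \<longrightarrow>
           (\<forall>k<\<kappa> c. (total_deriv f ^^ k) Y (t, x, U) $ c = z t x $ \<sigma> (c, k)) \<and>
           (total_deriv f ^^ \<kappa> c) Y (t, x, U) $ c = w t x (Poly_Mapping.lookup U 0) $ c))"


section \<open>Flat outputs\<close>

definition nth_vector_derivative :: "nat \<Rightarrow> (real \<Rightarrow> 'a::real_normed_vector) \<Rightarrow> real \<Rightarrow> 'a" where
  "nth_vector_derivative k c = ((\<lambda>h t. vector_derivative h (at t)) ^^ k) c"

text \<open>The sequence \<open>(c, c', \<dots>)\<close> of derivatives of \<open>c\<close> at \<open>t\<close>, up to order \<open>p\<close>.\<close>

definition curve_jet :: "nat \<Rightarrow> (real \<Rightarrow> 'a::real_normed_vector) \<Rightarrow> real \<Rightarrow> (nat \<Rightarrow>\<^sub>0 'a)" where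
  "curve_jet p c t = (\<Sum>k\<le>p. Poly_Mapping.single k (nth_vector_derivative k c t))"

definition trajectory_on ::
  "real set \<Rightarrow> ('n::finite, 'm::finite) system \<Rightarrow> (real \<Rightarrow> real^'n) \<Rightarrow> (real \<Rightarrow> real^'m) \<Rightarrow> bool" where
  "trajectory_on I f x u \<longleftrightarrow>
     open I \<and> is_interval I \<and> smooth_on I u \<and>
     (\<forall>t\<in>I. (x has_vector_derivative f t (x t) (u t)) (at t))"

text \<open>\<open>F\<close> does not depend on the derivatives of the input of order greater than \<open>K\<close>.\<close>

definition jet_order_le :: "nat \<Rightarrow> (('n::finite, 'm::finite) jet \<Rightarrow> 'b) \<Rightarrow> bool" where
  "jet_order_le K F \<longleftrightarrow>
     (\<forall>t x U V. (\<forall>k\<le>K. Poly_Mapping.lookup U k = Poly_Mapping.lookup V k) \<longrightarrow>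
        F (t, x, U) = F (t, x, V))"

text \<open>
  \<open>\<xi>\<close> and \<open>\<eta>\<close> are evaluated at sequences whose entries of order greater than \<open>p\<close>, respectively
  \<open>q\<close>, vanish, so they are functions of finitely many derivatives of the flat output.
\<close>

definition flat_output_on ::
  "('n, 'm) jet set \<Rightarrow> ('n::finite, 'm::finite) system \<Rightarrow> (('n, 'm) jet \<Rightarrow> real^'m) \<Rightarrow> bool" where
  "flat_output_on \<Omega> f Y \<longleftrightarrow>
     open \<Omega> \<and> smooth_on \<Omega> Y \<and>
     (\<exists>K. jet_order_le K Y \<and> jet_order_le K (\<lambda>j. j \<in> \<Omega>) \<and>
       (\<exists>p q A B (\<xi> :: (nat \<Rightarrow>\<^sub>0 real^'m) \<Rightarrow> real^'n) (\<eta> :: (nat \<Rightarrow>\<^sub>0 real^'m) \<Rightarrow> real^'m).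
          open A \<and> smooth_on A \<xi> \<and> open B \<and> smooth_on B \<eta> \<and>
          (\<forall>I x u. trajectory_on I f x u \<and> (\<forall>t\<in>I. (t, x t, curve_jet K u t) \<in> \<Omega>) \<longrightarrow>
             (let y = (\<lambda>t. Y (t, x t, curve_jet K u t)) in
                \<forall>t\<in>I. curve_jet p y t \<in> A \<and> x t = \<xi> (curve_jet p y t) \<and>
                       curve_jet q y t \<in> B \<and> u t = \<eta> (curve_jet q y t)))))"


section \<open>The vessel and its prolongation\<close>

text \<open>State \<open>(x, y, \<theta>, u, v, r)\<close>, input \<open>(u\<^sub>1, u\<^sub>2)\<close>.\<close>

definition vessel :: "real \<Rightarrow> real \<Rightarrow> real \<Rightarrow> real \<Rightarrow> real \<Rightarrow> (6, 2) system" where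
  "vessel \<gamma>1 \<gamma>2 \<beta>1 \<beta>2 \<beta>3 = (\<lambda>t X U.
     let \<theta> = X$3; u = X$4; v = X$5; r = X$6 in
     vector
       [u * cos \<theta> - v * sin \<theta>,
        u * sin \<theta> + v * cos \<theta>,
        r,
        1 / \<gamma>1 * v * r - \<beta>1 * u + U$1,
        - \<gamma>1 * u * r - \<beta>2 * v,
        \<gamma>2 * u * v - \<beta>3 * r + U$2])"

text \<open>
  State \<open>(x, y, \<theta>, u, v, r, ub\<^sub>2, ub\<^sub>2\<^sub>1, ub\<^sub>2\<^sub>2, ub\<^sub>2\<^sub>3)\<close>, input \<open>(u\<^sub>1, ub\<^sub>2\<^sub>4)\<close>,
  where \<open>ub\<close> stands for \<open>u\<close> with a bar.
\<close>

definition prolonged_vessel :: "real \<Rightarrow> real \<Rightarrow> real \<Rightarrow> (10, 2) system" where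
  "prolonged_vessel \<gamma>1 \<beta>1 \<beta>2 = (\<lambda>t X U.
     let \<theta> = X$3; u = X$4; v = X$5; r = X$6 in
     vector
       [u * cos \<theta> - v * sin \<theta>,
        u * sin \<theta> + v * cos \<theta>,
        r,
        1 / \<gamma>1 * v * r - \<beta>1 * u + U$1,
        - \<gamma>1 * u * r - \<beta>2 * v,
        X$7, X$8, X$9, X$10, U$2])"

definition output1 ::
  "real \<Rightarrow> real \<Rightarrow> real \<Rightarrow> real \<Rightarrow> real \<Rightarrow> real \<Rightarrow> real \<Rightarrow> real \<Rightarrow> real" where
  "output1 \<gamma>1 \<beta>2 x y \<theta> v r ub2 =
     (let z = Complex x y in
        r * v + \<gamma>1 / (1 + \<gamma>1) *
          ((1 + \<gamma>1) * r\<^sup>2 * Re (z * cis (- \<theta>)) + (\<beta>2 * r + ub2) * Im (z * cis (- \<theta>))))"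

definition Delta :: "real \<Rightarrow> real \<Rightarrow> real \<Rightarrow> real \<Rightarrow> real \<Rightarrow> real" where
  "Delta \<gamma>1 \<beta>2 r ub2 ub21 =
     \<gamma>1 ^ 4 / (1 + \<gamma>1) ^ 5 *
     ((1 + \<gamma>1)\<^sup>2 * r ^ 4 - (1 + 2 * \<gamma>1) * ub2\<^sup>2 + (1 + \<gamma>1) * r * ub21
        + \<beta>2 * (\<beta>2 * r\<^sup>2 + (1 - \<gamma>1) * r * ub2)) ^ 4"

definition prolonged_output :: "real \<Rightarrow> real \<Rightarrow> (10, 2) jet \<Rightarrow> real^2" where
  "prolonged_output \<gamma>1 \<beta>2 = (\<lambda>(t, X, U).
     vector [output1 \<gamma>1 \<beta>2 (X$1) (X$2) (X$3) (X$5) (X$6) (X$7), X$3])"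

definition ubar2 :: "real \<Rightarrow> real \<Rightarrow> (6, 2) jet \<Rightarrow> real" where
  "ubar2 \<gamma>2 \<beta>3 = (\<lambda>(t, X, U).
     Poly_Mapping.lookup U 0 $ 2 + \<gamma>2 * (X$4) * (X$5) - \<beta>3 * (X$6))"

definition vessel_output :: "real \<Rightarrow> real \<Rightarrow> real \<Rightarrow> real \<Rightarrow> (6, 2) jet \<Rightarrow> real^2" where
  "vessel_output \<gamma>1 \<gamma>2 \<beta>2 \<beta>3 = (\<lambda>(t, X, U).
     vector [output1 \<gamma>1 \<beta>2 (X$1) (X$2) (X$3) (X$5) (X$6) (ubar2 \<gamma>2 \<beta>3 (t, X, U)), X$3])"

text \<open>
  The set where \<open>\<Delta> \<noteq> 0\<close> in terms of the original system, on which the derivative of \<open>ub\<^sub>2\<close>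
  (and hence \<open>\<Delta>\<close>) involves the first derivative of the input.
\<close>

definition vessel_regular :: "real \<Rightarrow> real \<Rightarrow> real \<Rightarrow> real \<Rightarrow> real \<Rightarrow> (6, 2) jet set" where
  "vessel_regular \<gamma>1 \<gamma>2 \<beta>1 \<beta>2 \<beta>3 =
     {(t, X, U). Delta \<gamma>1 \<beta>2 (X$6) (ubar2 \<gamma>2 \<beta>3 (t, X, U))
        (total_deriv (vessel \<gamma>1 \<gamma>2 \<beta>1 \<beta>2 \<beta>3) (ubar2 \<gamma>2 \<beta>3) (t, X, U)) \<noteq> 0}"

text \<open>
  In coordinates \<open>P = (t, x, y, \<theta>, u, v, r, ub\<^sub>2, ub\<^sub>2\<^sub>1, ub\<^sub>2\<^sub>2, ub\<^sub>2\<^sub>3, u\<^sub>1, ub\<^sub>2\<^sub>4)\<close>. The derivatives of the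
  input are set to zero; the outputs' derivatives that occur here do not depend on them.
\<close>

definition linearizing_map :: "real \<Rightarrow> real \<Rightarrow> real \<Rightarrow> real^13 \<Rightarrow> real^13" where
  "linearizing_map \<gamma>1 \<beta>1 \<beta>2 P =
     (let X = vector [P$2, P$3, P$4, P$5, P$6, P$7, P$8, P$9, P$10, P$11] :: real^10;
          U = vector [P$12, P$13] :: real^2;
          d = (\<lambda>k. (total_deriv (prolonged_vessel \<gamma>1 \<beta>1 \<beta>2) ^^ k) (prolonged_output \<gamma>1 \<beta>2)
                     (P$1, X, Poly_Mapping.single 0 U))
      in vector
          [P$1,
           d 0 $ 1, d 1 $ 1, d 2 $ 1, d 3 $ 1, d 4 $ 1,
           d 0 $ 2, d 1 $ 2, d 2 $ 2, d 3 $ 2, d 4 $ 2, d 5 $ 2, d 6 $ 2])"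

end

(*
  In the body frame put xi = Re (z exp (- i theta)) and eta = Im (z exp (- i theta)). Then
  xi' = u + r eta and eta' = v - r xi, so (xi, eta, v) is driven by u through a linear system whose
  coefficients depend on r only, and y1 = A xi + B eta + C v with A, B, C differential polynomials
  in r. The coefficient of u cancels in the first two derivatives of y1; in the third it is a
  nonzero multiple of Q, where Delta is a multiple of Q^4. The 3x3 determinant expressing
  (y1, y1', y1'') in (xi, eta, v) is a multiple of Q^2. Where Q is nonzero, Cramer's rule recovers
  xi, eta, v from y1, y1', y1'' and the derivatives of theta, then y1''' gives u and y1'''' gives
  u'. This explicit inverse serves both the static feedback transformation (so no inverse function
  theorem is needed) and the flat parametrization, and the same triangular structure gives the
  Jacobian: Delta = (multiple of Q^2) * (multiple of Q)^2.
*)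
theory Submission
  imports Defs
begin

section \<open>Calculus of smooth maps\<close>

text \<open>Origin of y1: normalise the coefficient of v to r. Then u drops out of y1' exactly when
  the coefficient of xi is \<gamma>1 r^2, and, where r is nonzero, out of y1'' exactly when the
  coefficient of eta is \<gamma>1 / (1 + \<gamma>1) (\<beta>2 r + r'). Since that coefficient
  contains r', the k-th derivative of y1 contains r up to order k + 1. The fourth one therefore
  brings in r of order 5 together with u'. Four differentiations of the second input turn exactly
  this derivative of r into an input, which gives the chain orders 4 and 6. The chain is
  differentiated in three settings: total derivatives in jet space, the differential of the
  coordinate change, and genuine trajectories. To do it once, the jets of r and u are abstract
  sequences, and the derivative rules assume derivatives at a single point only. A straight line
  with the right velocity then serves as well as a trajectory. Lines yield only directional
  derivatives, so differentiability is supplied separately by a small calculus of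
  \<open>Ck_on\<close>.\<close>

lemma frechet_derivative_eqI:
  "(f has_derivative f') (at x) \<Longrightarrow> frechet_derivative f (at x) = f'"
  by (metis frechet_derivative_at)

text \<open>Openness carries the induction: a derivative at a point of \<open>S\<close> sees a
  neighbourhood, and agreement on an open \<open>S\<close> provides one.\<close>

lemma Ck_on_cong:
  assumes "open S" and "\<And>x. x \<in> S \<Longrightarrow> f x = g x" and "Ck_on k S f"
  shows "Ck_on k S g"
  using assms(2,3)
proof (induction k arbitrary: f g)
  case 0
  then show ?case by (simp cong: continuous_on_cong)
next
  case (Suc k)
  have D: "(g has_derivative frechet_derivative f (at x)) (at x)" if x: "x \<in> S" for x
  proof -
    have "(f has_derivative frechet_derivative f (at x)) (at x)"
      using Suc.prems(2) x by (simp add: frechet_derivative_works)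
    then show ?thesis
      by (rule has_derivative_transform_within_open[OF _ \<open>open S\<close> x]) (use Suc.prems(1) in auto)
  qed
  have "Ck_on k S (\<lambda>x. frechet_derivative g (at x) v)" for v
  proof (rule Suc.IH)
    show "frechet_derivative f (at x) v = frechet_derivative g (at x) v" if "x \<in> S" for x
      using frechet_derivative_eqI[OF D[OF that]] by simp
    show "Ck_on k S (\<lambda>x. frechet_derivative f (at x) v)"
      using Suc.prems(2) by simp
  qed
  then show ?case
    using D by (auto intro: differentiableI)
qed

text \<open>Allows the derivative to be given in closed form instead of as
  \<open>frechet_derivative\<close>.\<close>

lemma Ck_on_SucI:
  assumes "open S" and D: "\<And>x. x \<in> S \<Longrightarrow> (f has_derivative f' x) (at x)"
    and "\<And>v. Ck_on k S (\<lambda>x. f' x v)"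
  shows "Ck_on (Suc k) S f"
proof -
  have "Ck_on k S (\<lambda>x. frechet_derivative f (at x) v)" for v
    by (rule Ck_on_cong[OF \<open>open S\<close> _ assms(3)[of v]]) (simp add: frechet_derivative_eqI[OF D])
  then show ?thesis
    using D by (auto intro: differentiableI)
qed

lemma Ck_on_SucD:
  assumes "Ck_on (Suc k) S f" and "x \<in> S"
  shows "(f has_derivative frechet_derivative f (at x)) (at x)"
  using assms by (simp add: frechet_derivative_works)

lemma Ck_on_Suc_imp: "Ck_on (Suc k) S f \<Longrightarrow> Ck_on k S f"
proof (induction k arbitrary: f)
  case 0
  then show ?case
    by (simp add: continuous_at_imp_continuous_on differentiable_imp_continuous_within)
qed auto

lemma Ck_on_const: "open S \<Longrightarrow> Ck_on k S (\<lambda>x. c)"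
  by (induction k arbitrary: c) (auto intro!: Ck_on_SucI[where f' = "\<lambda>x v. 0"])

lemma Ck_on_bounded_linear:
  assumes "open S" and "bounded_linear L" and "Ck_on k S f"
  shows "Ck_on k S (\<lambda>x. L (f x))"
  using assms(3)
proof (induction k arbitrary: f)
  case 0
  then show ?case
    by (simp add: bounded_linear.continuous_on[OF assms(2)])
next
  case (Suc k)
  show ?case
  proof (rule Ck_on_SucI[OF \<open>open S\<close>])
    show "((\<lambda>x. L (f x)) has_derivative (\<lambda>v. L (frechet_derivative f (at x) v))) (at x)"
      if "x \<in> S" for x
      using bounded_linear.has_derivative[OF assms(2) Ck_on_SucD[OF Suc.prems that]] .
    show "Ck_on k S (\<lambda>x. L (frechet_derivative f (at x) v))" for v
      using Suc by simp
  qed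
qed

lemma Ck_on_linear_map:
  assumes "open S" and "bounded_linear L"
  shows "Ck_on k S L"
proof (cases k)
  case 0
  then show ?thesis by (simp add: assms(2) linear_continuous_on)
next
  case (Suc j)
  then show ?thesis
    using assms
    by (auto intro!: Ck_on_SucI[where f' = "\<lambda>x. L"] Ck_on_const
        simp: bounded_linear_imp_has_derivative simp del: Ck_on.simps)
qed

lemma Ck_on_add:
  assumes "open S" and "Ck_on k S f" and "Ck_on k S g"
  shows "Ck_on k S (\<lambda>x. f x + g x)"
  using assms(2,3)
proof (induction k arbitrary: f g)
  case 0
  then show ?case by (simp add: continuous_on_add)
next
  case (Suc k)
  show ?case
  proof (rule Ck_on_SucI[OF \<open>open S\<close>])
    show "((\<lambda>x. f x + g x) has_derivative
        (\<lambda>v. frechet_derivative f (at x) v + frechet_derivative g (at x) v)) (at x)"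
      if "x \<in> S" for x
      using Ck_on_SucD[OF Suc.prems(1) that] Ck_on_SucD[OF Suc.prems(2) that]
      by (rule has_derivative_add)
    show "Ck_on k S (\<lambda>x. frechet_derivative f (at x) v + frechet_derivative g (at x) v)" for v
      using Suc by simp
  qed
qed

lemma Ck_on_uminus:
  "open S \<Longrightarrow> Ck_on k S f \<Longrightarrow> Ck_on k S (\<lambda>x. - f x)"
  by (rule Ck_on_bounded_linear) (auto intro: bounded_linear_minus bounded_linear_ident)

lemma Ck_on_diff:
  "open S \<Longrightarrow> Ck_on k S f \<Longrightarrow> Ck_on k S g \<Longrightarrow> Ck_on k S (\<lambda>x. f x - g x)"
  using Ck_on_add[of S k f "\<lambda>x. - g x"] by (simp add: Ck_on_uminus)

lemma Ck_on_sum: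
  assumes "open S" and "\<And>i. i \<in> I \<Longrightarrow> Ck_on k S (f i)"
  shows "Ck_on k S (\<lambda>x. \<Sum>i\<in>I. f i x)"
  using assms(2)
  by (induction I rule: infinite_finite_induct)
    (auto intro!: Ck_on_add[OF \<open>open S\<close>] Ck_on_const[OF \<open>open S\<close>])

text \<open>The product rule pairs each undifferentiated factor with a derivative of class
  \<open>k\<close>, so the factors themselves are lowered from \<open>Suc k\<close> to
  \<open>k\<close> before the induction hypothesis applies.\<close>

lemma Ck_on_mult:
  fixes f g :: "'a::real_normed_vector \<Rightarrow> real"
  assumes "open S" and "Ck_on k S f" and "Ck_on k S g"
  shows "Ck_on k S (\<lambda>x. f x * g x)"
  using assms(2,3)
proof (induction k arbitrary: f g)
  case 0
  then show ?case by (simp add: continuous_on_mult)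
next
  case (Suc k)
  show ?case
  proof (rule Ck_on_SucI[OF \<open>open S\<close>])
    show "((\<lambda>x. f x * g x) has_derivative
        (\<lambda>v. f x * frechet_derivative g (at x) v + frechet_derivative f (at x) v * g x)) (at x)"
      if "x \<in> S" for x
      using Ck_on_SucD[OF Suc.prems(1) that] Ck_on_SucD[OF Suc.prems(2) that]
      by (rule has_derivative_mult)
    show "Ck_on k S (\<lambda>x. f x * frechet_derivative g (at x) v
        + frechet_derivative f (at x) v * g x)" for v
      using Suc.prems Suc.IH Ck_on_Suc_imp[OF Suc.prems(1)] Ck_on_Suc_imp[OF Suc.prems(2)]
      by (intro Ck_on_add[OF \<open>open S\<close>] Suc.IH) auto
  qed
qed

lemma Ck_on_power:
  fixes f :: "'a::real_normed_vector \<Rightarrow> real"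
  shows "open S \<Longrightarrow> Ck_on k S f \<Longrightarrow> Ck_on k S (\<lambda>x. f x ^ n)"
  by (induction n) (auto intro!: Ck_on_mult Ck_on_const)

text \<open>The derivatives of sine and cosine refer to each other, hence one simultaneous
  induction.\<close>

lemma Ck_on_sin_cos:
  fixes f :: "'a::real_normed_vector \<Rightarrow> real"
  assumes "open S" and "Ck_on k S f"
  shows "Ck_on k S (\<lambda>x. sin (f x)) \<and> Ck_on k S (\<lambda>x. cos (f x))"
  using assms(2)
proof (induction k arbitrary: f)
  case 0
  then show ?case by (auto intro: continuous_intros)
next
  case (Suc k)
  have IH: "Ck_on k S (\<lambda>x. sin (f x))" "Ck_on k S (\<lambda>x. cos (f x))"
    using Suc.IH Ck_on_Suc_imp[OF Suc.prems] by blast+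
  have D: "Ck_on k S (\<lambda>x. frechet_derivative f (at x) v)" for v
    using Suc.prems by simp
  have "Ck_on (Suc k) S (\<lambda>x. sin (f x))"
  proof (rule Ck_on_SucI[OF \<open>open S\<close>])
    show "((\<lambda>x. sin (f x)) has_derivative
        (\<lambda>v. frechet_derivative f (at x) v * cos (f x))) (at x)" if "x \<in> S" for x
      using Ck_on_SucD[OF Suc.prems that] by (rule has_derivative_sin)
    show "Ck_on k S (\<lambda>x. frechet_derivative f (at x) v * cos (f x))" for v
      by (intro Ck_on_mult[OF \<open>open S\<close>] IH D)
  qed
  moreover have "Ck_on (Suc k) S (\<lambda>x. cos (f x))"
  proof (rule Ck_on_SucI[OF \<open>open S\<close>])
    show "((\<lambda>x. cos (f x)) has_derivative
        (\<lambda>v. frechet_derivative f (at x) v * - sin (f x))) (at x)" if "x \<in> S" for x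
      using Ck_on_SucD[OF Suc.prems that] by (rule has_derivative_cos)
    show "Ck_on k S (\<lambda>x. frechet_derivative f (at x) v * - sin (f x))" for v
      by (intro Ck_on_mult[OF \<open>open S\<close>] Ck_on_uminus[OF \<open>open S\<close>] IH D)
  qed
  ultimately show ?case by blast
qed

text \<open>The derivative of 1/f consists of 1/f twice and the derivative of f, so the induction
  can keep f fixed.\<close>

lemma Ck_on_inverse:
  fixes f :: "'a::real_normed_vector \<Rightarrow> real"
  assumes "open S" and nz: "\<And>x. x \<in> S \<Longrightarrow> f x \<noteq> 0" and "Ck_on k S f"
  shows "Ck_on k S (\<lambda>x. inverse (f x))"
  using assms(3)
proof (induction k)
  case 0
  then show ?case using nz by (auto intro: continuous_intros)
next
  case (Suc k)
  show ?case
  proof (rule Ck_on_SucI[OF \<open>open S\<close>])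
    show "((\<lambda>x. inverse (f x)) has_derivative
        (\<lambda>v. - (inverse (f x) * frechet_derivative f (at x) v * inverse (f x)))) (at x)"
      if "x \<in> S" for x
      using Deriv.has_derivative_inverse[OF nz[OF that] Ck_on_SucD[OF Suc.prems that]] .
    show "Ck_on k S (\<lambda>x. - (inverse (f x) * frechet_derivative f (at x) v * inverse (f x)))" for v
      using Suc.prems Suc.IH[OF Ck_on_Suc_imp[OF Suc.prems]]
      by (intro Ck_on_uminus[OF \<open>open S\<close>] Ck_on_mult[OF \<open>open S\<close>]) auto
  qed
qed

lemma Ck_on_divide:
  fixes f g :: "'a::real_normed_vector \<Rightarrow> real"
  assumes "open S" and "Ck_on k S f" and "Ck_on k S g" and "\<And>x. x \<in> S \<Longrightarrow> g x \<noteq> 0"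
  shows "Ck_on k S (\<lambda>x. f x / g x)"
  using assms by (simp add: divide_inverse Ck_on_mult Ck_on_inverse)

lemma Ck_on_sin: "open S \<Longrightarrow> Ck_on k S f \<Longrightarrow> Ck_on k S (\<lambda>x. sin (f x :: real))"
  and Ck_on_cos: "open S \<Longrightarrow> Ck_on k S f \<Longrightarrow> Ck_on k S (\<lambda>x. cos (f x :: real))"
  using Ck_on_sin_cos by blast+

lemma Ck_on_Pair:
  assumes "open S" and "Ck_on k S f" and "Ck_on k S g"
  shows "Ck_on k S (\<lambda>x. (f x, g x))"
proof -
  have "Ck_on k S (\<lambda>x. (f x, 0) + (0, g x))"
    using assms
    by (intro Ck_on_add Ck_on_bounded_linear[of S "\<lambda>a. (a, 0)"] Ck_on_bounded_linear[of S "\<lambda>a. (0, a)"]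
        bounded_linear_Pair bounded_linear_ident bounded_linear_zero)
  then show ?thesis by simp
qed

lemma Ck_on_vec_nth:
  "open S \<Longrightarrow> Ck_on k S f \<Longrightarrow> Ck_on k S (\<lambda>x. f x $ i)"
  by (rule Ck_on_bounded_linear[OF _ bounded_linear_vec_nth])

lemma Ck_on_fst: "open S \<Longrightarrow> Ck_on k S f \<Longrightarrow> Ck_on k S (\<lambda>x. fst (f x))"
  and Ck_on_snd: "open S \<Longrightarrow> Ck_on k S f \<Longrightarrow> Ck_on k S (\<lambda>x. snd (f x))"
  by (rule Ck_on_bounded_linear[OF _ bounded_linear_fst]
      Ck_on_bounded_linear[OF _ bounded_linear_snd]; assumption)+

lemma Ck_on_componentwise:
  fixes f :: "'a::real_normed_vector \<Rightarrow> real^'n::finite"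
  assumes "open S" and "\<And>i. Ck_on k S (\<lambda>x. f x $ i)"
  shows "Ck_on k S f"
proof -
  have "Ck_on k S (\<lambda>x. \<Sum>i\<in>UNIV. (f x $ i) *\<^sub>R (axis i 1 :: real^'n))"
    using assms
    by (intro Ck_on_sum Ck_on_bounded_linear[of S "\<lambda>c. c *\<^sub>R _"] bounded_linear_scaleR_left)
  moreover have "(\<lambda>x. \<Sum>i\<in>UNIV. (f x $ i) *\<^sub>R axis i 1) = f"
    by (simp add: fun_eq_iff vec_eq_iff axis_def if_distrib[of "\<lambda>c. _ * c"] cong: if_cong)
  ultimately show ?thesis by (simp only:)
qed

section \<open>Entries of a finitely supported sequence as bounded linear functionals\<close>

lemma lookup_scaleR:
  "Poly_Mapping.lookup (c *\<^sub>R p) k = c *\<^sub>R Poly_Mapping.lookup p k"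
  for p :: "'a \<Rightarrow>\<^sub>0 'b::real_vector"
proof -
  have "finite {i. c *\<^sub>R Poly_Mapping.lookup p i \<noteq> 0}"
    by (rule finite_subset[OF _ finite_keys[of p]]) (auto simp: in_keys_iff)
  then show ?thesis
    by (simp add: scaleR_poly_mapping_def Abs_poly_mapping_inverse)
qed

text \<open>The norm is the sum of the norms of the entries. Every entry is thus a bounded
  functional, and functions of finitely many input derivatives are smooth on jet space as soon as
  they are smooth in those entries.\<close>

lemma norm_lookup_le: "norm (Poly_Mapping.lookup p k) \<le> norm p"
  for p :: "'a \<Rightarrow>\<^sub>0 'b::real_normed_vector"
proof (cases "k \<in> Poly_Mapping.keys p")
  case True
  then have "norm (Poly_Mapping.lookup p k) \<le> (\<Sum>n\<in>Poly_Mapping.keys p. norm (Poly_Mapping.lookup p n))"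
    by (intro member_le_sum) auto
  then show ?thesis by (simp add: norm_poly_mapping_def dist_poly_mapping_def)
next
  case False
  then show ?thesis by (simp add: in_keys_iff)
qed

lemma bounded_linear_lookup:
  "bounded_linear (\<lambda>p :: 'a \<Rightarrow>\<^sub>0 'b::real_normed_vector. Poly_Mapping.lookup p k)"
  by (rule bounded_linear_intro[where K = 1])
    (simp_all add: lookup_add lookup_scaleR norm_lookup_le)

lemma Ck_on_lookup:
  "open S \<Longrightarrow> Ck_on k S f \<Longrightarrow> Ck_on k S (\<lambda>x. Poly_Mapping.lookup (f x) i)"
  by (rule Ck_on_bounded_linear[OF _ bounded_linear_lookup])

lemma Ck_on_ident: "open S \<Longrightarrow> Ck_on k S (\<lambda>x. x)"
  by (rule Ck_on_linear_map) (simp_all add: bounded_linear_ident)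

lemmas Ck_intros = Ck_on_ident Ck_on_const Ck_on_add Ck_on_diff Ck_on_uminus Ck_on_mult Ck_on_divide
  Ck_on_power Ck_on_sin Ck_on_cos Ck_on_Pair Ck_on_vec_nth Ck_on_fst Ck_on_snd Ck_on_lookup

lemma smooth_onI: "(\<And>k. Ck_on k S f) \<Longrightarrow> smooth_on S f"
  and smooth_onD: "smooth_on S f \<Longrightarrow> Ck_on k S f"
  by (simp_all add: smooth_on_def)

lemma smooth_on_differentiable:
  "smooth_on S f \<Longrightarrow> x \<in> S \<Longrightarrow> f differentiable (at x)"
  using smooth_onD[of S f "Suc 0"] by auto

section \<open>The chain generated by the first output\<close>

text \<open>
  A jet is the sequence of a function and its derivatives at a point; \<open>leib\<close> is the product of jets,
  with Leibniz' rule as its recursion.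
\<close>

primrec leib :: "nat \<Rightarrow> (nat \<Rightarrow> real) \<Rightarrow> (nat \<Rightarrow> real) \<Rightarrow> real" where
  "leib 0 p q = p 0 * q 0"
| "leib (Suc j) p q = leib j (\<lambda>i. p (Suc i)) q + leib j p (\<lambda>i. q (Suc i))"

text \<open>Differentiation in time is a shift of the order. The hypotheses concern the one point
  \<open>t\<close> but all orders \<open>i\<close>, so they survive the shifts made by the
  recursion.\<close>

lemma leib_has_derivative:
  assumes "\<And>i. ((\<lambda>s. p s i) has_real_derivative p t (Suc i)) (at t)"
    and "\<And>i. ((\<lambda>s. q s i) has_real_derivative q t (Suc i)) (at t)"
  shows "((\<lambda>s. leib j (p s) (q s)) has_real_derivative leib (Suc j) (p t) (q t)) (at t)"
  using assms
proof (induction j arbitrary: p q)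
  case 0
  then show ?case
    using DERIV_mult'[OF "0"(1)[of 0] "0"(2)[of 0]] by (simp add: add.commute)
next
  case (Suc j)
  have "((\<lambda>s. leib j (\<lambda>i. p s (Suc i)) (q s)) has_real_derivative
      leib (Suc j) (\<lambda>i. p t (Suc i)) (q t)) (at t)"
    by (rule Suc.IH) (rule Suc.prems)+
  moreover have "((\<lambda>s. leib j (p s) (\<lambda>i. q s (Suc i))) has_real_derivative
      leib (Suc j) (p t) (\<lambda>i. q t (Suc i))) (at t)"
    by (rule Suc.IH) (rule Suc.prems)+
  ultimately show ?case
    unfolding leib.simps(2)[of j] leib.simps(2)[of "Suc j"] by (rule DERIV_add)
qed

lemma leib_cong:
  assumes "\<And>i. i \<le> j \<Longrightarrow> p i = p' i" and "\<And>i. i \<le> j \<Longrightarrow> q i = q' i"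
  shows "leib j p q = leib j p' q'"
  using assms
proof (induction j arbitrary: p q p' q')
  case (Suc j)
  have "leib j (\<lambda>i. p (Suc i)) q = leib j (\<lambda>i. p' (Suc i)) q'"
    and "leib j p (\<lambda>i. q (Suc i)) = leib j p' (\<lambda>i. q' (Suc i))"
    by (rule Suc.IH; simp add: Suc.prems)+
  then show ?case by simp
qed simp

lemma Ck_on_leib:
  assumes "open S" and "\<And>i. Ck_on k S (\<lambda>x. p x i)" and "\<And>i. Ck_on k S (\<lambda>x. q x i)"
  shows "Ck_on k S (\<lambda>x. leib j (p x) (q x))"
  using assms(2,3)
  by (induction j arbitrary: p q)
    (simp_all add: Ck_on_mult[OF \<open>open S\<close>] Ck_on_add[OF \<open>open S\<close>])

text \<open>
  Along the vessel the \<open>k\<close>-th derivative of the first output is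
  \<open>A\<^sub>k \<xi> + B\<^sub>k \<eta> + C\<^sub>k v\<close> plus terms in \<open>u\<close> and its derivatives. Index \<open>j\<close> is the \<open>j\<close>-th derivative
  of the coefficient, \<open>w\<close> the jet of the yaw rate \<open>r\<close>, and \<open>g\<close>, \<open>b\<close> are \<open>\<gamma>\<^sub>1\<close>, \<open>\<beta>\<^sub>2\<close>.
\<close>

fun coefA coefB coefC :: "real \<Rightarrow> real \<Rightarrow> (nat \<Rightarrow> real) \<Rightarrow> nat \<Rightarrow> nat \<Rightarrow> real" where
  "coefA g b w 0 = (\<lambda>j. g * leib j w w)"
| "coefA g b w (Suc k) = (\<lambda>j. coefA g b w k (Suc j) - leib j w (coefB g b w k))"
| "coefB g b w 0 = (\<lambda>j. g / (1 + g) * (b * w j + w (Suc j)))"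
| "coefB g b w (Suc k) = (\<lambda>j. coefB g b w k (Suc j) + leib j w (coefA g b w k))"
| "coefC g b w 0 = w"
| "coefC g b w (Suc k) = (\<lambda>j. coefC g b w k (Suc j) - b * coefC g b w k j + coefB g b w k j)"

lemma coef_has_derivative:
  assumes "\<And>i. ((\<lambda>s. w s i) has_real_derivative w t (Suc i)) (at t)"
  shows "((\<lambda>s. coefA g b (w s) k j) has_real_derivative coefA g b (w t) k (Suc j)) (at t)"
    and "((\<lambda>s. coefB g b (w s) k j) has_real_derivative coefB g b (w t) k (Suc j)) (at t)"
    and "((\<lambda>s. coefC g b (w s) k j) has_real_derivative coefC g b (w t) k (Suc j)) (at t)"
proof (induction k arbitrary: j)
  case 0
  {
    case 1
    show ?case
      by (auto intro!: DERIV_cmult leib_has_derivative assms simp del: leib.simps)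
  next
    case 2
    show ?case by (auto intro!: DERIV_cmult DERIV_add assms simp del: times_divide_eq_left)
  next
    case 3
    show ?case by (simp add: assms)
  }
next
  case (Suc k)
  {
    case 1
    show ?case
      by (auto intro!: DERIV_diff leib_has_derivative assms Suc simp del: leib.simps)
  next
    case 2
    show ?case
      by (auto intro!: DERIV_add leib_has_derivative assms Suc simp del: leib.simps)
  next
    case 3
    show ?case by (auto intro!: DERIV_add DERIV_diff DERIV_cmult Suc)
  }
qed

text \<open>\<open>coefB\<close> starts with the derivative of the yaw rate and stays one order
  ahead of the other two. The bounds survive the recursion because B enters A and C only when
  \<open>k\<close> is raised.\<close>

lemma coef_cong:
  shows "(\<And>i. i \<le> k + j \<Longrightarrow> w i = w' i) \<Longrightarrow> coefA g b w k j = coefA g b w' k j"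
    and "(\<And>i. i \<le> Suc (k + j) \<Longrightarrow> w i = w' i) \<Longrightarrow> coefB g b w k j = coefB g b w' k j"
    and "(\<And>i. i \<le> k + j \<Longrightarrow> w i = w' i) \<Longrightarrow> coefC g b w k j = coefC g b w' k j"
proof (induction k arbitrary: j)
  case 0
  {
    case 1
    then show ?case by (auto intro: leib_cong)
  next
    case 2
    then show ?case by simp
  next
    case 3
    then show ?case by simp
  }
next
  case (Suc k)
  {
    case 1
    have "leib j w (coefB g b w k) = leib j w' (coefB g b w' k)"
      by (rule leib_cong) (auto intro!: 1 Suc.IH)
    moreover have "coefA g b w k (Suc j) = coefA g b w' k (Suc j)"
      by (rule Suc.IH) (simp add: 1)
    ultimately show ?case by simp
  next
    case 2
    have "leib j w (coefA g b w k) = leib j w' (coefA g b w' k)"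
      by (rule leib_cong) (auto intro!: 2 Suc.IH)
    moreover have "coefB g b w k (Suc j) = coefB g b w' k (Suc j)"
      by (rule Suc.IH) (simp add: 2)
    ultimately show ?case by simp
  next
    case 3
    have "coefC g b w k (Suc j) = coefC g b w' k (Suc j)" "coefC g b w k j = coefC g b w' k j"
      "coefB g b w k j = coefB g b w' k j"
      by (rule Suc.IH; simp add: 3)+
    then show ?case by simp
  }
qed

lemma Ck_on_coef:
  assumes "open S" and "\<And>i. Ck_on n S (\<lambda>x. w x i)"
  shows "Ck_on n S (\<lambda>x. coefA g b (w x) k j)"
    and "Ck_on n S (\<lambda>x. coefB g b (w x) k j)"
    and "Ck_on n S (\<lambda>x. coefC g b (w x) k j)"
  by (induction k arbitrary: j)
    (simp_all add: assms Ck_on_leib Ck_on_add Ck_on_diff Ck_on_mult Ck_on_const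
      del: leib.simps times_divide_eq_left)

text \<open>The coefficient of \<open>u\<close> that appears when \<open>A\<^sub>k \<xi> + B\<^sub>k \<eta> + C\<^sub>k v\<close> is differentiated.\<close>

definition residual :: "real \<Rightarrow> real \<Rightarrow> (nat \<Rightarrow> real) \<Rightarrow> nat \<Rightarrow> nat \<Rightarrow> real" where
  "residual g b w k j = coefA g b w k j - g * leib j w (coefC g b w k)"

lemma residual_has_derivative:
  assumes "\<And>i. ((\<lambda>s. w s i) has_real_derivative w t (Suc i)) (at t)"
  shows "((\<lambda>s. residual g b (w s) k j) has_real_derivative residual g b (w t) k (Suc j)) (at t)"
  unfolding residual_def
  by (intro DERIV_diff DERIV_cmult coef_has_derivative leib_has_derivative assms)

lemma residual_cong:
  assumes "\<And>i. i \<le> k + j \<Longrightarrow> w i = w' i"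
  shows "residual g b w k j = residual g b w' k j"
proof -
  have "leib j w (coefC g b w k) = leib j w' (coefC g b w' k)"
    by (rule leib_cong) (auto intro!: assms coef_cong)
  then show ?thesis
    using coef_cong(1)[OF assms] by (simp add: residual_def)
qed

lemma Ck_on_residual:
  assumes "open S" and "\<And>i. Ck_on n S (\<lambda>x. w x i)"
  shows "Ck_on n S (\<lambda>x. residual g b (w x) k j)"
  unfolding residual_def
  by (intro Ck_on_diff Ck_on_mult Ck_on_const Ck_on_coef Ck_on_leib assms)

section \<open>Closed forms of the residuals and of the coefficient determinant in terms of
  Q\<close>

definition quartic :: "real \<Rightarrow> real \<Rightarrow> real \<Rightarrow> real \<Rightarrow> real \<Rightarrow> real" where
  "quartic g b r s s1 = (1 + g)\<^sup>2 * r ^ 4 - (1 + 2 * g) * s\<^sup>2 + (1 + g) * r * s1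
     + b * (b * r\<^sup>2 + (1 - g) * r * s)"

lemma Delta_eq_quartic: "Delta g b r s s1 = g ^ 4 / (1 + g) ^ 5 * quartic g b r s s1 ^ 4"
  by (simp add: Delta_def quartic_def)

lemma Delta_nonzero_iff:
  "g \<noteq> 0 \<Longrightarrow> g \<noteq> - 1 \<Longrightarrow> Delta g b r s s1 \<noteq> 0 \<longleftrightarrow> quartic g b r s s1 \<noteq> 0"
  by (auto simp: Delta_eq_quartic add_eq_0_iff)

definition coef_det :: "real \<Rightarrow> real \<Rightarrow> (nat \<Rightarrow> real) \<Rightarrow> real" where
  "coef_det g b w =
     coefA g b w 0 0 * (coefB g b w 1 0 * coefC g b w 2 0 - coefC g b w 1 0 * coefB g b w 2 0)
   - coefB g b w 0 0 * (coefA g b w 1 0 * coefC g b w 2 0 - coefC g b w 1 0 * coefA g b w 2 0)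
   + coefC g b w 0 0 * (coefA g b w 1 0 * coefB g b w 2 0 - coefB g b w 1 0 * coefA g b w 2 0)"

text \<open>The coefficients of the output are made for this. The choice A = g w C at order 0 gives
  the first identity. The second residual then equals w times g (b w + w') - (1 + g) B, which
  vanishes for the B in \<open>coefB\<close>; hence the factor g / (1 + g).\<close>

lemma residual_0_1:
  assumes "g \<noteq> - 1"
  shows "residual g b w 0 0 = 0" and "residual g b w 1 0 = 0"
proof -
  show "residual g b w 0 0 = 0" by (simp add: residual_def)
  have "1 + g \<noteq> 0" using assms by auto
  then show "residual g b w 1 0 = 0"
    by (simp add: residual_def divide_simps) algebra
qed

lemma residual_2:
  assumes "g \<noteq> - 1"
  shows "residual g b w 2 0 = - g / (1 + g) * quartic g b (w 0) (w 1) (w 2)"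
proof -
  have "1 + g \<noteq> 0" using assms by auto
  then show ?thesis
    by (simp add: residual_def quartic_def numeral_2_eq_2 divide_simps) algebra
qed

lemma coef_det_eq:
  assumes "g \<noteq> - 1"
  shows "coef_det g b w = g\<^sup>2 / (1 + g) ^ 3 * (quartic g b (w 0) (w 1) (w 2))\<^sup>2"
proof -
  \<comment> \<open>With g / (1 + g) kept as an atom subject to g = c (1 + g), the identity becomes
    polynomial.\<close>
  define c where "c = g / (1 + g)"
  have "1 + g \<noteq> 0" using assms by auto
  then have g: "g = c * (1 + g)" by (simp add: c_def)
  have "coef_det g b w * (1 + g) ^ 3 = g\<^sup>2 * (quartic g b (w 0) (w 1) (w 2))\<^sup>2"
    using g
    by (simp add: coef_det_def quartic_def numeral_2_eq_2 flip: c_def) algebra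
  then show ?thesis
    using \<open>1 + g \<noteq> 0\<close> by (simp add: field_simps)
qed

text \<open>Source of the constant in \<open>Delta\<close>: the determinant contributes g^2 / (1 +
  g)^3 and the squared residual g^2 / (1 + g)^2, each with a factor Q^2.\<close>

lemma coef_det_residual:
  assumes "g \<noteq> - 1"
  shows "coef_det g b w * (residual g b w 2 0)\<^sup>2 = Delta g b (w 0) (w 1) (w 2)"
proof -
  have "1 + g \<noteq> 0" using assms by auto
  then show ?thesis
    by (simp add: coef_det_eq residual_2 Delta_eq_quartic assms divide_simps) algebra
qed

section \<open>The derivatives of the first output as functions of body coordinates and jets\<close>

definition chain_lin ::
  "real \<Rightarrow> real \<Rightarrow> (nat \<Rightarrow> real) \<Rightarrow> nat \<Rightarrow> real \<Rightarrow> real \<Rightarrow> real \<Rightarrow> real" where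
  "chain_lin g b w k \<xi> \<eta> v = coefA g b w k 0 * \<xi> + coefB g b w k 0 * \<eta> + coefC g b w k 0 * v"

text \<open>
  \<open>\<mu>\<close> is the jet of \<open>u\<close>. Order 5 is needed because the sixth derivative of the vector-valued output
  makes sense only if its fifth is differentiable in both components.
\<close>

definition chain ::
  "real \<Rightarrow> real \<Rightarrow> (nat \<Rightarrow> real) \<Rightarrow> nat \<Rightarrow> real \<Rightarrow> real \<Rightarrow> real \<Rightarrow> (nat \<Rightarrow> real) \<Rightarrow> real" where
  "chain g b w k \<xi> \<eta> v \<mu> = chain_lin g b w k \<xi> \<eta> v +
     (if k = 3 then residual g b w 2 0 * \<mu> 0
      else if k = 4 then (residual g b w 2 1 + residual g b w 3 0) * \<mu> 0 + residual g b w 2 0 * \<mu> 1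
      else if k = 5 then (residual g b w 2 2 + residual g b w 3 1 + residual g b w 4 0) * \<mu> 0
        + (2 * residual g b w 2 1 + residual g b w 3 0) * \<mu> 1 + residual g b w 2 0 * \<mu> 2
      else 0)"

text \<open>The recursion of the coefficients is this computation: the terms in \<xi>, \<eta> and v
  form the next row, while u enters through the derivatives of \<xi> and v with the factors A and -
  g w C, whose sum is the residual.\<close>

lemma chain_lin_has_derivative:
  assumes "\<And>i. ((\<lambda>s. w s i) has_real_derivative w t (Suc i)) (at t)"
    and "(\<xi> has_real_derivative u + w t 0 * \<eta> t) (at t)"
    and "(\<eta> has_real_derivative v t - w t 0 * \<xi> t) (at t)"
    and "(v has_real_derivative - g * u * w t 0 - b * v t) (at t)"
  shows "((\<lambda>s. chain_lin g b (w s) k (\<xi> s) (\<eta> s) (v s)) has_real_derivative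
      chain_lin g b (w t) (Suc k) (\<xi> t) (\<eta> t) (v t) + residual g b (w t) k 0 * u) (at t)"
  unfolding chain_lin_def
  by (rule DERIV_cong, (rule DERIV_add DERIV_mult' coef_has_derivative assms)+)
    (simp add: residual_def algebra_simps)

text \<open>Up to order 3 the terms in u come from the residual alone. Afterwards the product rule
  acts on the existing terms in u, and each step adds the next residual.\<close>

lemma chain_has_derivative:
  assumes "g \<noteq> - 1" and "k < 5"
    and w: "\<And>i. ((\<lambda>s. w s i) has_real_derivative w t (Suc i)) (at t)"
    and \<mu>: "\<And>i. i < 2 \<Longrightarrow> ((\<lambda>s. \<mu> s i) has_real_derivative \<mu> t (Suc i)) (at t)"
    and "(\<xi> has_real_derivative \<mu> t 0 + w t 0 * \<eta> t) (at t)"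
    and "(\<eta> has_real_derivative v t - w t 0 * \<xi> t) (at t)"
    and "(v has_real_derivative - g * \<mu> t 0 * w t 0 - b * v t) (at t)"
  shows "((\<lambda>s. chain g b (w s) k (\<xi> s) (\<eta> s) (v s) (\<mu> s)) has_real_derivative
      chain g b (w t) (Suc k) (\<xi> t) (\<eta> t) (v t) (\<mu> t)) (at t)"
proof -
  note lin = chain_lin_has_derivative[of w t \<xi> "\<mu> t 0" \<eta> v g b k, OF w assms(5-7)]
  note res = residual_has_derivative[of w t g b, OF w]
  note \<mu>01 = \<mu>[of 0, simplified] \<mu>[of 1, simplified]
  consider "k = 0" | "k = 1" | "k = 2" | "k = 3" | "k = 4"
    using \<open>k < 5\<close> by linarith
  then show ?thesis
  proof cases
    case 1
    show ?thesis using lin by (simp add: 1 chain_def residual_0_1[OF assms(1)])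
  next
    case 2
    show ?thesis using lin residual_0_1(2)[OF assms(1), of b "w t"] by (simp add: 2 chain_def)
  next
    case 3
    show ?thesis using lin by (simp add: 3 chain_def)
  next
    case 4
    show ?thesis
      unfolding chain_def 4
      by (rule DERIV_cong, simp,
          (rule DERIV_add DERIV_mult' DERIV_cmult lin[unfolded 4] res \<mu>01)+)
        (simp add: algebra_simps)
  next
    case 5
    show ?thesis
      unfolding chain_def 5
      by (rule DERIV_cong, simp,
          (rule DERIV_add DERIV_mult' DERIV_cmult lin[unfolded 5] res \<mu>01)+)
        (simp add: algebra_simps numeral_2_eq_2)
  qed
qed

lemma chain_lin_cong:
  assumes "\<And>i. i \<le> Suc k \<Longrightarrow> w i = w' i"
  shows "chain_lin g b w k \<xi> \<eta> v = chain_lin g b w' k \<xi> \<eta> v"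
proof -
  have "coefA g b w k 0 = coefA g b w' k 0" "coefB g b w k 0 = coefB g b w' k 0"
    "coefC g b w k 0 = coefC g b w' k 0"
    by (rule coef_cong; simp add: assms)+
  then show ?thesis by (simp add: chain_lin_def)
qed

text \<open>These bounds fix which derivative sees which input: order \<open>k\<close> reads the yaw
  rate up to order k + 1 and u up to order k - 3.\<close>

lemma chain_cong:
  assumes w: "\<And>i. i \<le> Suc k \<Longrightarrow> w i = w' i"
    and "k \<le> 4" and \<mu>: "\<And>i. i + 3 \<le> k \<Longrightarrow> \<mu> i = \<mu>' i"
  shows "chain g b w k \<xi> \<eta> v \<mu> = chain g b w' k \<xi> \<eta> v \<mu>'"
proof -
  have res: "residual g b w i j = residual g b w' i j" if "i + j \<le> Suc k" for i j
    using that by (intro residual_cong w) simp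
  show ?thesis
    using assms(2) by (auto simp: chain_def chain_lin_cong[OF w] res \<mu>)
qed

lemma Ck_on_chain_lin:
  assumes "open S" and "\<And>i. Ck_on n S (\<lambda>x. w x i)"
    and "Ck_on n S \<xi>" and "Ck_on n S \<eta>" and "Ck_on n S v"
  shows "Ck_on n S (\<lambda>x. chain_lin g b (w x) k (\<xi> x) (\<eta> x) (v x))"
  unfolding chain_lin_def by (intro Ck_intros Ck_on_coef assms)

lemma Ck_on_chain:
  assumes "open S" and "\<And>i. Ck_on n S (\<lambda>x. w x i)"
    and "Ck_on n S \<xi>" and "Ck_on n S \<eta>" and "Ck_on n S v" and "\<And>i. Ck_on n S (\<lambda>x. \<mu> x i)"
  shows "Ck_on n S (\<lambda>x. chain g b (w x) k (\<xi> x) (\<eta> x) (v x) (\<mu> x))"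
proof -
  note [simp] = Ck_intros(2-)[OF \<open>open S\<close>] Ck_on_chain_lin[OF \<open>open S\<close>] Ck_on_residual[OF \<open>open S\<close>] assms
  show ?thesis
    unfolding chain_def by (cases "k = 3"; cases "k = 4"; cases "k = 5") simp_all
qed

text \<open>Cramer's rule for \<open>\<xi>\<close>, \<open>\<eta>\<close>, \<open>v\<close>; \<open>q k\<close> is the \<open>k\<close>-th derivative of the first output.\<close>

definition sol_xi :: "real \<Rightarrow> real \<Rightarrow> (nat \<Rightarrow> real) \<Rightarrow> (nat \<Rightarrow> real) \<Rightarrow> real" where
  "sol_xi g b w q =
    (q 0 * (coefB g b w 1 0 * coefC g b w 2 0 - coefC g b w 1 0 * coefB g b w 2 0)
   - coefB g b w 0 0 * (q 1 * coefC g b w 2 0 - coefC g b w 1 0 * q 2)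
   + coefC g b w 0 0 * (q 1 * coefB g b w 2 0 - coefB g b w 1 0 * q 2)) / coef_det g b w"

definition sol_eta :: "real \<Rightarrow> real \<Rightarrow> (nat \<Rightarrow> real) \<Rightarrow> (nat \<Rightarrow> real) \<Rightarrow> real" where
  "sol_eta g b w q =
    (coefA g b w 0 0 * (q 1 * coefC g b w 2 0 - coefC g b w 1 0 * q 2)
   - q 0 * (coefA g b w 1 0 * coefC g b w 2 0 - coefC g b w 1 0 * coefA g b w 2 0)
   + coefC g b w 0 0 * (coefA g b w 1 0 * q 2 - q 1 * coefA g b w 2 0)) / coef_det g b w"

definition sol_v :: "real \<Rightarrow> real \<Rightarrow> (nat \<Rightarrow> real) \<Rightarrow> (nat \<Rightarrow> real) \<Rightarrow> real" where
  "sol_v g b w q =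
    (coefA g b w 0 0 * (coefB g b w 1 0 * q 2 - q 1 * coefB g b w 2 0)
   - coefB g b w 0 0 * (coefA g b w 1 0 * q 2 - q 1 * coefA g b w 2 0)
   + q 0 * (coefA g b w 1 0 * coefB g b w 2 0 - coefB g b w 1 0 * coefA g b w 2 0)) / coef_det g b w"

definition sol_u :: "real \<Rightarrow> real \<Rightarrow> (nat \<Rightarrow> real) \<Rightarrow> (nat \<Rightarrow> real) \<Rightarrow> real" where
  "sol_u g b w q =
    (q 3 - chain_lin g b w 3 (sol_xi g b w q) (sol_eta g b w q) (sol_v g b w q)) / residual g b w 2 0"

definition sol_du :: "real \<Rightarrow> real \<Rightarrow> (nat \<Rightarrow> real) \<Rightarrow> (nat \<Rightarrow> real) \<Rightarrow> real" where
  "sol_du g b w q =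
    (q 4 - chain_lin g b w 4 (sol_xi g b w q) (sol_eta g b w q) (sol_v g b w q)
      - (residual g b w 2 1 + residual g b w 3 0) * sol_u g b w q) / residual g b w 2 0"

text \<open>Used twice: it shows that the feedback transformation is injective, and it is the flat
  parametrization.\<close>

lemma chain_inject:
  assumes "coef_det g b w \<noteq> 0" and "residual g b w 2 0 \<noteq> 0"
    and q: "\<And>k. k \<le> 4 \<Longrightarrow> q k = chain g b w k \<xi> \<eta> v \<mu>"
  shows "sol_xi g b w q = \<xi>" and "sol_eta g b w q = \<eta>" and "sol_v g b w q = v"
    and "sol_u g b w q = \<mu> 0" and "sol_du g b w q = \<mu> 1"
proof -
  have q012: "q 0 = chain_lin g b w 0 \<xi> \<eta> v" "q 1 = chain_lin g b w 1 \<xi> \<eta> v"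
    "q 2 = chain_lin g b w 2 \<xi> \<eta> v"
    using q[of 0] q[of 1] q[of 2] by (simp_all add: chain_def)
  show \<xi>: "sol_xi g b w q = \<xi>"
    \<comment> \<open>The denominator is cleared while the determinant is still folded; unfolding it
      afterwards leaves a polynomial identity.\<close>
    unfolding sol_xi_def q012 chain_lin_def nonzero_divide_eq_eq[OF assms(1)]
    unfolding coef_det_def by algebra
  show \<eta>: "sol_eta g b w q = \<eta>"
    unfolding sol_eta_def q012 chain_lin_def nonzero_divide_eq_eq[OF assms(1)]
    unfolding coef_det_def by algebra
  show v: "sol_v g b w q = v"
    unfolding sol_v_def q012 chain_lin_def nonzero_divide_eq_eq[OF assms(1)]
    unfolding coef_det_def by algebra
  show u: "sol_u g b w q = \<mu> 0"
    using assms(2) q[of 3] by (simp add: sol_u_def chain_def \<xi> \<eta> v)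
  show "sol_du g b w q = \<mu> 1"
    using assms(2) q[of 4] by (simp add: sol_du_def chain_def \<xi> \<eta> v u)
qed

text \<open>The converse direction: prescribed values of orders 0 to 4 are attained, so the explicit
  inverse is a right inverse as well.\<close>

lemma chain_surject:
  assumes d: "coef_det g b w \<noteq> 0" and r: "residual g b w 2 0 \<noteq> 0"
    and \<mu>: "\<mu> 0 = sol_u g b w q" "\<mu> 1 = sol_du g b w q" and "k \<le> 4"
  shows "chain g b w k (sol_xi g b w q) (sol_eta g b w q) (sol_v g b w q) \<mu> = q k"
proof -
  \<comment> \<open>Multiplied by the determinant, the Cramer solutions are polynomial, and so are
    the three identities that put them back into the linear system.\<close>
  have scaled: "sol_xi g b w q * coef_det g b w =
    q 0 * (coefB g b w 1 0 * coefC g b w 2 0 - coefC g b w 1 0 * coefB g b w 2 0)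
   - coefB g b w 0 0 * (q 1 * coefC g b w 2 0 - coefC g b w 1 0 * q 2)
   + coefC g b w 0 0 * (q 1 * coefB g b w 2 0 - coefB g b w 1 0 * q 2)"
    "sol_eta g b w q * coef_det g b w =
    coefA g b w 0 0 * (q 1 * coefC g b w 2 0 - coefC g b w 1 0 * q 2)
   - q 0 * (coefA g b w 1 0 * coefC g b w 2 0 - coefC g b w 1 0 * coefA g b w 2 0)
   + coefC g b w 0 0 * (coefA g b w 1 0 * q 2 - q 1 * coefA g b w 2 0)"
    "sol_v g b w q * coef_det g b w =
    coefA g b w 0 0 * (coefB g b w 1 0 * q 2 - q 1 * coefB g b w 2 0)
   - coefB g b w 0 0 * (coefA g b w 1 0 * q 2 - q 1 * coefA g b w 2 0)
   + q 0 * (coefA g b w 1 0 * coefB g b w 2 0 - coefB g b w 1 0 * coefA g b w 2 0)"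
    using d by (simp_all add: sol_xi_def sol_eta_def sol_v_def)
  have lin: "chain_lin g b w k (sol_xi g b w q) (sol_eta g b w q) (sol_v g b w q) * coef_det g b w
      = coefA g b w k 0 * (sol_xi g b w q * coef_det g b w)
      + coefB g b w k 0 * (sol_eta g b w q * coef_det g b w)
      + coefC g b w k 0 * (sol_v g b w q * coef_det g b w)" for k
    by (simp add: chain_lin_def algebra_simps)
  consider "k = 0" | "k = 1" | "k = 2" | "k = 3" | "k = 4"
    using \<open>k \<le> 4\<close> by linarith
  then show ?thesis
  proof cases
    case 1
    have "chain_lin g b w 0 (sol_xi g b w q) (sol_eta g b w q) (sol_v g b w q) * coef_det g b w
        = q 0 * coef_det g b w"
      unfolding lin scaled unfolding coef_det_def by algebra
    then show ?thesis using d by (simp add: 1 chain_def)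
  next
    case 2
    have "chain_lin g b w 1 (sol_xi g b w q) (sol_eta g b w q) (sol_v g b w q) * coef_det g b w
        = q 1 * coef_det g b w"
      unfolding lin scaled unfolding coef_det_def by algebra
    then show ?thesis using d by (simp add: 2 chain_def)
  next
    case 3
    have "chain_lin g b w 2 (sol_xi g b w q) (sol_eta g b w q) (sol_v g b w q) * coef_det g b w
        = q 2 * coef_det g b w"
      unfolding lin scaled unfolding coef_det_def by algebra
    then show ?thesis using d by (simp add: 3 chain_def)
  next
    case 4
    show ?thesis using r by (simp add: 4 chain_def \<mu> sol_u_def)
  next
    case 5
    show ?thesis using r by (simp add: 5 chain_def \<mu>(2)[unfolded One_nat_def] \<mu>(1) sol_du_def)
  qed
qed

lemma Ck_on_coef_det:
  assumes "open S" and "\<And>i. Ck_on n S (\<lambda>x. w x i)"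
  shows "Ck_on n S (\<lambda>x. coef_det g b (w x))"
  unfolding coef_det_def by (intro Ck_intros Ck_on_coef assms)

lemma Ck_on_sol:
  assumes "open S" and "\<And>i. Ck_on n S (\<lambda>x. w x i)" and "\<And>i. Ck_on n S (\<lambda>x. q x i)"
    and "\<And>x. x \<in> S \<Longrightarrow> coef_det g b (w x) \<noteq> 0"
    and "\<And>x. x \<in> S \<Longrightarrow> residual g b (w x) 2 0 \<noteq> 0"
  shows "Ck_on n S (\<lambda>x. sol_xi g b (w x) (q x))" and "Ck_on n S (\<lambda>x. sol_eta g b (w x) (q x))"
    and "Ck_on n S (\<lambda>x. sol_v g b (w x) (q x))" and "Ck_on n S (\<lambda>x. sol_u g b (w x) (q x))"
    and "Ck_on n S (\<lambda>x. sol_du g b (w x) (q x))"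
proof -
  show \<xi>: "Ck_on n S (\<lambda>x. sol_xi g b (w x) (q x))"
    unfolding sol_xi_def by (intro Ck_intros Ck_on_coef Ck_on_coef_det assms) assumption
  show \<eta>: "Ck_on n S (\<lambda>x. sol_eta g b (w x) (q x))"
    unfolding sol_eta_def by (intro Ck_intros Ck_on_coef Ck_on_coef_det assms) assumption
  show v: "Ck_on n S (\<lambda>x. sol_v g b (w x) (q x))"
    unfolding sol_v_def by (intro Ck_intros Ck_on_coef Ck_on_coef_det assms) assumption
  show u: "Ck_on n S (\<lambda>x. sol_u g b (w x) (q x))"
    unfolding sol_u_def by (intro Ck_intros Ck_on_chain_lin Ck_on_residual \<xi> \<eta> v assms) assumption
  show "Ck_on n S (\<lambda>x. sol_du g b (w x) (q x))"
    unfolding sol_du_def by (intro Ck_intros Ck_on_chain_lin Ck_on_residual \<xi> \<eta> v u assms) assumption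
qed

lemma chain_regular:
  assumes "g \<noteq> 0" and "g \<noteq> - 1" and "quartic g b (w 0) (w 1) (w 2) \<noteq> 0"
  shows "coef_det g b w \<noteq> 0" and "residual g b w 2 0 \<noteq> 0"
  using assms by (auto simp: coef_det_eq residual_2 add_eq_0_iff)

section \<open>Position in the body frame\<close>

definition body_xi :: "real \<Rightarrow> real \<Rightarrow> real \<Rightarrow> real" where
  "body_xi x y \<theta> = x * cos \<theta> + y * sin \<theta>"

definition body_eta :: "real \<Rightarrow> real \<Rightarrow> real \<Rightarrow> real" where
  "body_eta x y \<theta> = y * cos \<theta> - x * sin \<theta>"

lemma earth_body:
  "body_xi x y \<theta> * cos \<theta> - body_eta x y \<theta> * sin \<theta> = x"
  "body_xi x y \<theta> * sin \<theta> + body_eta x y \<theta> * cos \<theta> = y"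
  "body_xi (\<xi> * cos \<theta> - \<eta> * sin \<theta>) (\<xi> * sin \<theta> + \<eta> * cos \<theta>) \<theta> = \<xi>"
  "body_eta (\<xi> * cos \<theta> - \<eta> * sin \<theta>) (\<xi> * sin \<theta> + \<eta> * cos \<theta>) \<theta> = \<eta>"
  unfolding body_xi_def body_eta_def using sin_cos_squared_add[of \<theta>] by algebra+

lemma body_has_derivative:
  assumes "(x has_real_derivative u * cos (\<theta> t) - v * sin (\<theta> t)) (at t)"
    and "(y has_real_derivative u * sin (\<theta> t) + v * cos (\<theta> t)) (at t)"
    and "(\<theta> has_real_derivative r) (at t)"
  shows "((\<lambda>s. body_xi (x s) (y s) (\<theta> s)) has_real_derivative
      u + r * body_eta (x t) (y t) (\<theta> t)) (at t)"
    and "((\<lambda>s. body_eta (x s) (y s) (\<theta> s)) has_real_derivative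
      v - r * body_xi (x t) (y t) (\<theta> t)) (at t)"
  unfolding body_xi_def body_eta_def
  using sin_cos_squared_add[of "\<theta> t"]
  by - (rule DERIV_cong,
      (rule DERIV_add DERIV_diff DERIV_mult' DERIV_fun_sin DERIV_fun_cos assms)+, algebra)+

lemma Ck_on_body:
  assumes "open S" and "Ck_on n S x" and "Ck_on n S y" and "Ck_on n S \<theta>"
  shows "Ck_on n S (\<lambda>s. body_xi (x s) (y s) (\<theta> s))" and "Ck_on n S (\<lambda>s. body_eta (x s) (y s) (\<theta> s))"
  unfolding body_xi_def body_eta_def by (intro Ck_intros assms)+

text \<open>The real and imaginary parts of z exp (- i \<theta>) are the body coordinates. At order
  0 only two entries of the yaw jet are read and none of \<open>\<mu>\<close>, so any sequences with
  these entries will do.\<close>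

lemma output1_eq_chain:
  assumes "g \<noteq> - 1" and "w 0 = r" and "w 1 = ub"
  shows "output1 g b x y \<theta> v r ub = chain g b w 0 (body_xi x y \<theta>) (body_eta x y \<theta>) v \<mu>"
proof -
  have "1 + g \<noteq> 0" using assms(1) by auto
  then show ?thesis
    using assms
    by (simp add: output1_def chain_def chain_lin_def body_xi_def body_eta_def power2_eq_square
        divide_simps) (simp add: algebra_simps)
qed

section \<open>Coordinate vectors\<close>

lemma vector_6:
  "(vector [x1, x2, x3, x4, x5, x6] :: 'a::zero^6) $ 1 = x1"
  "(vector [x1, x2, x3, x4, x5, x6] :: 'a::zero^6) $ 2 = x2"
  "(vector [x1, x2, x3, x4, x5, x6] :: 'a::zero^6) $ 3 = x3"
  "(vector [x1, x2, x3, x4, x5, x6] :: 'a::zero^6) $ 4 = x4"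
  "(vector [x1, x2, x3, x4, x5, x6] :: 'a::zero^6) $ 5 = x5"
  "(vector [x1, x2, x3, x4, x5, x6] :: 'a::zero^6) $ 6 = x6"
  by (simp_all add: vector_def)

lemma vector_10:
  "(vector [x1, x2, x3, x4, x5, x6, x7, x8, x9, x10] :: 'a::zero^10) $ 1 = x1"
  "(vector [x1, x2, x3, x4, x5, x6, x7, x8, x9, x10] :: 'a::zero^10) $ 2 = x2"
  "(vector [x1, x2, x3, x4, x5, x6, x7, x8, x9, x10] :: 'a::zero^10) $ 3 = x3"
  "(vector [x1, x2, x3, x4, x5, x6, x7, x8, x9, x10] :: 'a::zero^10) $ 4 = x4"
  "(vector [x1, x2, x3, x4, x5, x6, x7, x8, x9, x10] :: 'a::zero^10) $ 5 = x5"
  "(vector [x1, x2, x3, x4, x5, x6, x7, x8, x9, x10] :: 'a::zero^10) $ 6 = x6"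
  "(vector [x1, x2, x3, x4, x5, x6, x7, x8, x9, x10] :: 'a::zero^10) $ 7 = x7"
  "(vector [x1, x2, x3, x4, x5, x6, x7, x8, x9, x10] :: 'a::zero^10) $ 8 = x8"
  "(vector [x1, x2, x3, x4, x5, x6, x7, x8, x9, x10] :: 'a::zero^10) $ 9 = x9"
  "(vector [x1, x2, x3, x4, x5, x6, x7, x8, x9, x10] :: 'a::zero^10) $ 10 = x10"
  by (simp_all add: vector_def)

lemma vector_13:
  "(vector [x1, x2, x3, x4, x5, x6, x7, x8, x9, x10, x11, x12, x13] :: 'a::zero^13) $ 1 = x1"
  "(vector [x1, x2, x3, x4, x5, x6, x7, x8, x9, x10, x11, x12, x13] :: 'a::zero^13) $ 2 = x2"
  "(vector [x1, x2, x3, x4, x5, x6, x7, x8, x9, x10, x11, x12, x13] :: 'a::zero^13) $ 3 = x3"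
  "(vector [x1, x2, x3, x4, x5, x6, x7, x8, x9, x10, x11, x12, x13] :: 'a::zero^13) $ 4 = x4"
  "(vector [x1, x2, x3, x4, x5, x6, x7, x8, x9, x10, x11, x12, x13] :: 'a::zero^13) $ 5 = x5"
  "(vector [x1, x2, x3, x4, x5, x6, x7, x8, x9, x10, x11, x12, x13] :: 'a::zero^13) $ 6 = x6"
  "(vector [x1, x2, x3, x4, x5, x6, x7, x8, x9, x10, x11, x12, x13] :: 'a::zero^13) $ 7 = x7"
  "(vector [x1, x2, x3, x4, x5, x6, x7, x8, x9, x10, x11, x12, x13] :: 'a::zero^13) $ 8 = x8"
  "(vector [x1, x2, x3, x4, x5, x6, x7, x8, x9, x10, x11, x12, x13] :: 'a::zero^13) $ 9 = x9"
  "(vector [x1, x2, x3, x4, x5, x6, x7, x8, x9, x10, x11, x12, x13] :: 'a::zero^13) $ 10 = x10"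
  "(vector [x1, x2, x3, x4, x5, x6, x7, x8, x9, x10, x11, x12, x13] :: 'a::zero^13) $ 11 = x11"
  "(vector [x1, x2, x3, x4, x5, x6, x7, x8, x9, x10, x11, x12, x13] :: 'a::zero^13) $ 12 = x12"
  "(vector [x1, x2, x3, x4, x5, x6, x7, x8, x9, x10, x11, x12, x13] :: 'a::zero^13) $ 13 = x13"
  by (simp_all add: vector_def)

lemma forall_6:
  "(\<forall>i::6. P i) \<longleftrightarrow> P 1 \<and> P 2 \<and> P 3 \<and> P 4 \<and> P 5 \<and> P 6"
proof -
  have "i = 1 \<or> i = 2 \<or> i = 3 \<or> i = 4 \<or> i = 5 \<or> i = 6" for i :: 6
  proof (induct i)
    case (of_int z)
    then have "0 \<le> z" "z < 6" by simp_all
    \<comment> \<open>In the type \<open>6\<close> the numeral 6 equals 0, so z = 0 accounts for the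
      last disjunct.\<close>
    then have "z = 0 \<or> z = 1 \<or> z = 2 \<or> z = 3 \<or> z = 4 \<or> z = 5" by presburger
    then show ?case by auto
  qed
  then show ?thesis by metis
qed

lemma forall_10:
  "(\<forall>i::10. P i) \<longleftrightarrow> P 1 \<and> P 2 \<and> P 3 \<and> P 4 \<and> P 5 \<and> P 6 \<and> P 7 \<and> P 8 \<and> P 9 \<and> P 10"
proof -
  have "i = 1 \<or> i = 2 \<or> i = 3 \<or> i = 4 \<or> i = 5 \<or> i = 6 \<or> i = 7 \<or> i = 8 \<or> i = 9 \<or> i = 10" for i :: 10
  proof (induct i)
    case (of_int z)
    then have "0 \<le> z" "z < 10" by simp_all
    then have "z = 0 \<or> z = 1 \<or> z = 2 \<or> z = 3 \<or> z = 4 \<or> z = 5 \<or> z = 6 \<or> z = 7 \<or> z = 8 \<or> z = 9" by presburger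
    then show ?case by auto
  qed
  then show ?thesis by metis
qed

lemma forall_13:
  "(\<forall>i::13. P i) \<longleftrightarrow> P 1 \<and> P 2 \<and> P 3 \<and> P 4 \<and> P 5 \<and> P 6 \<and> P 7 \<and> P 8 \<and> P 9 \<and> P 10 \<and> P 11 \<and> P 12 \<and> P 13"
proof -
  have "i = 1 \<or> i = 2 \<or> i = 3 \<or> i = 4 \<or> i = 5 \<or> i = 6 \<or> i = 7 \<or> i = 8 \<or> i = 9 \<or> i = 10 \<or> i = 11 \<or> i = 12 \<or> i = 13" for i :: 13
  proof (induct i)
    case (of_int z)
    then have "0 \<le> z" "z < 13" by simp_all
    then have "z = 0 \<or> z = 1 \<or> z = 2 \<or> z = 3 \<or> z = 4 \<or> z = 5 \<or> z = 6 \<or> z = 7 \<or> z = 8 \<or> z = 9 \<or> z = 10 \<or> z = 11 \<or> z = 12" by presburger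
    then show ?case by auto
  qed
  then show ?thesis by metis
qed

section \<open>Time derivatives along a system\<close>

text \<open>Reduces total derivatives, entries of the Jacobian and the transport of the vector field
  to ordinary derivatives in one real variable. Differentiability has to be known beforehand, as a
  directional derivative alone does not give it.\<close>

lemma frechet_derivative_line:
  fixes L :: "'b::real_normed_vector \<Rightarrow> real"
  assumes "bounded_linear L" and "F differentiable (at p)"
    and "((\<lambda>s. L (F (p + s *\<^sub>R v))) has_real_derivative d) (at 0)"
  shows "L (frechet_derivative F (at p) v) = d"
proof -
  have "((\<lambda>s. p + s *\<^sub>R v) has_derivative (\<lambda>h. h *\<^sub>R v)) (at (0::real))"
    by (auto intro!: derivative_eq_intros)
  moreover have "(F has_derivative frechet_derivative F (at p)) (at (p + (0::real) *\<^sub>R v))"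
    using assms(2) by (simp add: frechet_derivative_works)
  ultimately have "((\<lambda>s. F (p + s *\<^sub>R v)) has_derivative
      (\<lambda>h. frechet_derivative F (at p) (h *\<^sub>R v))) (at (0::real))"
    by (rule has_derivative_compose)
  then have "((\<lambda>s. L (F (p + s *\<^sub>R v))) has_derivative
      (\<lambda>h. L (frechet_derivative F (at p) (h *\<^sub>R v)))) (at (0::real))"
    by (rule bounded_linear.has_derivative[OF assms(1)])
  with assms(3) have "(*) d = (\<lambda>h. L (frechet_derivative F (at p) (h *\<^sub>R v)))"
    by (auto intro: has_derivative_unique simp: has_field_derivative_def)
  from fun_cong[OF this, of 1] show ?thesis by simp
qed

lemmas frechet_derivative_nth_line = frechet_derivative_line[OF bounded_linear_vec_nth]

lemma lookup_map_key_Suc: "Poly_Mapping.lookup (Poly_Mapping.map_key Suc U) k = Poly_Mapping.lookup U (Suc k)"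
  by (simp add: map_key.rep_eq)

lemma total_deriv_line:
  fixes L :: "'b::real_normed_vector \<Rightarrow> real"
  assumes "bounded_linear L" and "F differentiable (at (t, X, U))"
    and "((\<lambda>s. L (F (t + s, X + s *\<^sub>R f t X (Poly_Mapping.lookup U 0),
        U + s *\<^sub>R Poly_Mapping.map_key Suc U))) has_real_derivative d) (at 0)"
  shows "L (total_deriv f F (t, X, U)) = d"
  unfolding total_deriv_def prod.case
  by (rule frechet_derivative_line[OF assms(1,2)]) (use assms(3) in simp)

lemmas total_deriv_nthI = total_deriv_line[OF bounded_linear_vec_nth]

lemma line_has_derivative:
  "((\<lambda>s. (X + s *\<^sub>R V) $ i) has_real_derivative V $ i) (at 0)"
  by (auto intro!: derivative_eq_intros)

lemma lookup_line_has_derivative: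
  "((\<lambda>s. Poly_Mapping.lookup (U + s *\<^sub>R Poly_Mapping.map_key Suc U) k $ i)
    has_real_derivative Poly_Mapping.lookup U (Suc k) $ i) (at 0)"
  by (auto intro!: derivative_eq_intros simp: lookup_add lookup_scaleR lookup_map_key_Suc)


section \<open>The prolonged vessel\<close>

lemma prolonged_vessel_nth:
  "prolonged_vessel g b1 b2 t X u $ 1 = X$4 * cos (X$3) - X$5 * sin (X$3)"
  "prolonged_vessel g b1 b2 t X u $ 2 = X$4 * sin (X$3) + X$5 * cos (X$3)"
  "prolonged_vessel g b1 b2 t X u $ 3 = X$6"
  "prolonged_vessel g b1 b2 t X u $ 4 = 1 / g * X$5 * X$6 - b1 * X$4 + u$1"
  "prolonged_vessel g b1 b2 t X u $ 5 = - g * X$4 * X$6 - b2 * X$5"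
  "prolonged_vessel g b1 b2 t X u $ 6 = X$7"
  "prolonged_vessel g b1 b2 t X u $ 7 = X$8"
  "prolonged_vessel g b1 b2 t X u $ 8 = X$9"
  "prolonged_vessel g b1 b2 t X u $ 9 = X$10"
  "prolonged_vessel g b1 b2 t X u $ 10 = u$2"
  by (simp_all add: prolonged_vessel_def Let_def vector_10)

text \<open>Five entries of the jet of r are states of the prolonged system; from order 5 on they
  are the second input and its derivatives.\<close>

definition yaw_jet :: "real^10 \<Rightarrow> (nat \<Rightarrow> real^2) \<Rightarrow> nat \<Rightarrow> real" where
  "yaw_jet X U i =
    (if i = 0 then X$6 else if i = 1 then X$7 else if i = 2 then X$8
     else if i = 3 then X$9 else if i = 4 then X$10 else U (i - 5) $ 2)"

text \<open>Obtained by differentiating the surge equation and inserting the equations for v and r.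
  Order 2 is the highest that \<open>chain\<close> reads; it also serves as the default
  beyond.\<close>

definition surge_jet :: "real \<Rightarrow> real \<Rightarrow> real \<Rightarrow> real^10 \<Rightarrow> (nat \<Rightarrow> real^2) \<Rightarrow> nat \<Rightarrow> real" where
  "surge_jet g b1 b2 X U i =
    (if i = 0 then X$4 else if i = 1 then 1 / g * X$5 * X$6 - b1 * X$4 + U 0 $ 1
     else 1 / g * ((- g * X$4 * X$6 - b2 * X$5) * X$6 + X$5 * X$7)
       - b1 * (1 / g * X$5 * X$6 - b1 * X$4 + U 0 $ 1) + U 1 $ 1)"

definition surge_chain ::
  "real \<Rightarrow> real \<Rightarrow> real \<Rightarrow> nat \<Rightarrow> real^10 \<Rightarrow> (nat \<Rightarrow> real^2) \<Rightarrow> real" where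
  "surge_chain g b1 b2 k X U = chain g b2 (yaw_jet X U) k (body_xi (X$1) (X$2) (X$3))
     (body_eta (X$1) (X$2) (X$3)) (X$5) (surge_jet g b1 b2 X U)"

definition yaw_chain :: "nat \<Rightarrow> real^10 \<Rightarrow> (nat \<Rightarrow> real^2) \<Rightarrow> real" where
  "yaw_chain k X U = (if k = 0 then X$3 else yaw_jet X U (k - 1))"

text \<open>The curves have to follow the system only to first order at \<open>t\<close>, so the
  line from a jet in the direction used by \<open>total_deriv\<close> qualifies.\<close>

context
  fixes g b1 b2 t :: real and X :: "real \<Rightarrow> real^10" and U :: "real \<Rightarrow> nat \<Rightarrow> real^2"
  assumes X: "\<And>i. ((\<lambda>s. X s $ i) has_real_derivative
      prolonged_vessel g b1 b2 t (X t) (U t 0) $ i) (at t)"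
    and U: "\<And>k i. ((\<lambda>s. U s k $ i) has_real_derivative U t (Suc k) $ i) (at t)"
begin

lemmas prolonged_state_has_derivative =
  X[of 1, unfolded prolonged_vessel_nth] X[of 2, unfolded prolonged_vessel_nth]
  X[of 3, unfolded prolonged_vessel_nth] X[of 4, unfolded prolonged_vessel_nth]
  X[of 5, unfolded prolonged_vessel_nth] X[of 6, unfolded prolonged_vessel_nth]
  X[of 7, unfolded prolonged_vessel_nth] X[of 8, unfolded prolonged_vessel_nth]
  X[of 9, unfolded prolonged_vessel_nth] X[of 10, unfolded prolonged_vessel_nth]

lemma yaw_jet_has_derivative:
  "((\<lambda>s. yaw_jet (X s) (U s) i) has_real_derivative yaw_jet (X t) (U t) (Suc i)) (at t)"
proof -
  consider "i = 0" | "i = 1" | "i = 2" | "i = 3" | "i = 4" | "i \<ge> 5" by linarith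
  then show ?thesis
  proof cases
    case 6
    then have "Suc i - 5 = Suc (i - 5)" by simp
    with 6 U[of "i - 5" 2] show ?thesis by (simp add: yaw_jet_def)
  qed (use prolonged_state_has_derivative U[of 0 2] in \<open>simp_all add: yaw_jet_def\<close>)
qed

lemma yaw_chain_has_derivative:
  "((\<lambda>s. yaw_chain k (X s) (U s)) has_real_derivative yaw_chain (Suc k) (X t) (U t)) (at t)"
  using yaw_jet_has_derivative[of "k - 1"] prolonged_state_has_derivative(3)
  by (cases k) (simp_all add: yaw_chain_def, simp add: yaw_jet_def)

lemma surge_jet_has_derivative:
  assumes "i < 2"
  shows "((\<lambda>s. surge_jet g b1 b2 (X s) (U s) i) has_real_derivative
      surge_jet g b1 b2 (X t) (U t) (Suc i)) (at t)"
proof -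
  consider "i = 0" | "i = 1" using assms by linarith
  then show ?thesis
  proof cases
    case 1
    then show ?thesis using prolonged_state_has_derivative(4) by (simp add: surge_jet_def)
  next
    case 2
    have "((\<lambda>s. 1 / g * X s $ 5 * X s $ 6 - b1 * X s $ 4 + U s 0 $ 1) has_real_derivative
        surge_jet g b1 b2 (X t) (U t) 2) (at t)"
      by (rule DERIV_cong,
          (rule DERIV_add DERIV_diff DERIV_cmult DERIV_mult' prolonged_state_has_derivative U)+)
        (simp add: surge_jet_def algebra_simps)
    then show ?thesis by (simp add: surge_jet_def 2 numeral_2_eq_2)
  qed
qed

lemma surge_chain_has_derivative:
  assumes "g \<noteq> - 1" and "k < 5"
  shows "((\<lambda>s. surge_chain g b1 b2 k (X s) (U s)) has_real_derivative
      surge_chain g b1 b2 (Suc k) (X t) (U t)) (at t)"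
proof -
  have 0: "yaw_jet (X t) (U t) 0 = X t $ 6" "surge_jet g b1 b2 (X t) (U t) 0 = X t $ 4"
    by (simp_all add: yaw_jet_def surge_jet_def)
  show ?thesis
    unfolding surge_chain_def
    by (rule chain_has_derivative[where w = "\<lambda>s. yaw_jet (X s) (U s)"
            and \<mu> = "\<lambda>s. surge_jet g b1 b2 (X s) (U s)"])
      (simp_all only: 0, (rule assms yaw_jet_has_derivative surge_jet_has_derivative
        body_has_derivative prolonged_state_has_derivative | assumption)+)
qed

end

lemma yaw_jet_cong:
  assumes "\<And>j. j + 5 \<le> i \<Longrightarrow> U j = V j"
  shows "yaw_jet X U i = yaw_jet X V i"
  using assms[of "i - 5"] by (simp add: yaw_jet_def)

lemma yaw_chain_cong:
  assumes "\<And>j. j + 6 \<le> k \<Longrightarrow> U j = V j"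
  shows "yaw_chain k X U = yaw_chain k X V"
  unfolding yaw_chain_def using yaw_jet_cong[of "k - 1" U V X] assms by auto

text \<open>Below order 4 no input occurs. Order 4 reads the current input twice, through u' and
  through r of order 5, but none of its derivatives.\<close>

lemma surge_chain_cong:
  assumes "k \<le> 4" and "\<And>j. j + 4 \<le> k \<Longrightarrow> U j = V j"
  shows "surge_chain g b1 b2 k X U = surge_chain g b1 b2 k X V"
  unfolding surge_chain_def
  by (rule chain_cong) (use assms in \<open>auto intro!: yaw_jet_cong simp: surge_jet_def\<close>)

lemma Ck_on_yaw_jet:
  assumes "open S" and "Ck_on n S X" and "\<And>i. Ck_on n S (\<lambda>x. U x i)"
  shows "Ck_on n S (\<lambda>x. yaw_jet (X x) (U x) i)"
  unfolding yaw_jet_def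
  by (cases "i = 0"; cases "i = 1"; cases "i = 2"; cases "i = 3"; cases "i = 4")
    (simp_all add: Ck_on_vec_nth assms)

lemma Ck_on_yaw_chain:
  assumes "open S" and "Ck_on n S X" and "\<And>i. Ck_on n S (\<lambda>x. U x i)"
  shows "Ck_on n S (\<lambda>x. yaw_chain k (X x) (U x))"
  unfolding yaw_chain_def
  by (cases "k = 0") (simp_all add: Ck_on_vec_nth Ck_on_yaw_jet assms)

lemma Ck_on_surge_chain:
  assumes "open S" and "Ck_on n S X" and "\<And>i. Ck_on n S (\<lambda>x. U x i)"
  shows "Ck_on n S (\<lambda>x. surge_chain g b1 b2 k (X x) (U x))"
proof -
  have "Ck_on n S (\<lambda>x. surge_jet g b1 b2 (X x) (U x) i)" for i
    unfolding surge_jet_def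
    by (cases "i = 0"; cases "i = 1"; simp del: times_divide_eq_left)
      (intro Ck_on_add Ck_on_diff Ck_on_mult Ck_on_uminus Ck_on_const Ck_on_vec_nth assms)+
  then show ?thesis
    unfolding surge_chain_def
    by (intro Ck_on_chain Ck_on_yaw_jet Ck_on_body Ck_on_vec_nth assms)
qed

definition output_jet :: "real \<Rightarrow> real \<Rightarrow> real \<Rightarrow> nat \<Rightarrow> (10, 2) jet \<Rightarrow> real^2" where
  "output_jet g b1 b2 k = (\<lambda>(t, X, U).
     vector [surge_chain g b1 b2 k X (Poly_Mapping.lookup U), yaw_chain k X (Poly_Mapping.lookup U)])"

lemma output_jet_differentiable: "output_jet g b1 b2 k differentiable (at j)"
proof (rule smooth_on_differentiable[OF smooth_onI])
  fix n
  have "Ck_on n UNIV (\<lambda>j :: (10, 2) jet.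
      surge_chain g b1 b2 k (fst (snd j)) (Poly_Mapping.lookup (snd (snd j))))"
    "Ck_on n UNIV (\<lambda>j :: (10, 2) jet. yaw_chain k (fst (snd j)) (Poly_Mapping.lookup (snd (snd j))))"
    by (intro Ck_on_surge_chain Ck_on_yaw_chain Ck_on_fst Ck_on_snd Ck_on_lookup Ck_on_ident open_UNIV)+
  then have "Ck_on n UNIV (\<lambda>j. output_jet g b1 b2 k j $ i)" for i
    using exhaust_2[of i] by (auto simp: output_jet_def case_prod_beta)
  then show "Ck_on n UNIV (output_jet g b1 b2 k)"
    by (intro Ck_on_componentwise) simp_all
qed simp

lemma total_deriv_output_jet:
  assumes "g \<noteq> - 1"
  shows "k < 5 \<Longrightarrow> total_deriv (prolonged_vessel g b1 b2) (output_jet g b1 b2 k) (t, X, U) $ 1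
      = output_jet g b1 b2 (Suc k) (t, X, U) $ 1"
    and "total_deriv (prolonged_vessel g b1 b2) (output_jet g b1 b2 k) (t, X, U) $ 2
      = output_jet g b1 b2 (Suc k) (t, X, U) $ 2"
proof -
  let ?X = "\<lambda>s. X + s *\<^sub>R prolonged_vessel g b1 b2 t X (Poly_Mapping.lookup U 0)"
    and ?U = "\<lambda>s. Poly_Mapping.lookup (U + s *\<^sub>R Poly_Mapping.map_key Suc U)"
  \<comment> \<open>The system is autonomous, so the parameter of the line can start at 0 whatever
    \<open>t\<close> is.\<close>
  have X: "((\<lambda>s. ?X s $ i) has_real_derivative
      prolonged_vessel g b1 b2 0 (?X 0) (?U 0 0) $ i) (at 0)" for i
    using line_has_derivative[of X "prolonged_vessel g b1 b2 t X (Poly_Mapping.lookup U 0)" i]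
    by (simp add: prolonged_vessel_def)
  have U: "((\<lambda>s. ?U s k $ i) has_real_derivative ?U 0 (Suc k) $ i) (at 0)" for i k
    using lookup_line_has_derivative[of U k i] by simp
  show "total_deriv (prolonged_vessel g b1 b2) (output_jet g b1 b2 k) (t, X, U) $ 1
      = output_jet g b1 b2 (Suc k) (t, X, U) $ 1" if "k < 5"
    by (rule total_deriv_nthI[OF output_jet_differentiable])
      (use surge_chain_has_derivative[of ?X g b1 b2 0 ?U k, OF X U assms that]
        in \<open>simp add: output_jet_def\<close>)
  show "total_deriv (prolonged_vessel g b1 b2) (output_jet g b1 b2 k) (t, X, U) $ 2
      = output_jet g b1 b2 (Suc k) (t, X, U) $ 2"
    by (rule total_deriv_nthI[OF output_jet_differentiable])
      (use yaw_chain_has_derivative[of ?X g b1 b2 0 ?U k, OF X U]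
        in \<open>simp add: output_jet_def\<close>)
qed

lemma prolonged_output_derivs:
  assumes "g \<noteq> - 1"
  shows "k \<le> 5 \<Longrightarrow> (total_deriv (prolonged_vessel g b1 b2) ^^ k) (prolonged_output g b2)
      = output_jet g b1 b2 k"
    and "k \<le> 6 \<Longrightarrow> (total_deriv (prolonged_vessel g b1 b2) ^^ k) (prolonged_output g b2) (t, X, U) $ 2
      = yaw_chain k X (Poly_Mapping.lookup U)"
proof -
  show *: "(total_deriv (prolonged_vessel g b1 b2) ^^ k) (prolonged_output g b2)
      = output_jet g b1 b2 k" if "k \<le> 5" for k
    using that
  proof (induction k)
    case 0
    show ?case
      using output1_eq_chain[OF assms, of "yaw_jet _ _"]
      by (simp add: fun_eq_iff vec_eq_iff forall_2 prolonged_output_def output_jet_def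
          surge_chain_def yaw_chain_def yaw_jet_def)
  next
    case (Suc k)
    then have "(total_deriv (prolonged_vessel g b1 b2) ^^ k) (prolonged_output g b2)
        = output_jet g b1 b2 k" by simp
    moreover have "total_deriv (prolonged_vessel g b1 b2) (output_jet g b1 b2 k)
        = output_jet g b1 b2 (Suc k)"
      using Suc.prems by (simp add: fun_eq_iff vec_eq_iff forall_2 total_deriv_output_jet[OF assms])
    ultimately show ?case by simp
  qed
  show "(total_deriv (prolonged_vessel g b1 b2) ^^ k) (prolonged_output g b2) (t, X, U) $ 2
      = yaw_chain k X (Poly_Mapping.lookup U)" if "k \<le> 6"
  proof (cases "k \<le> 5")
    case True
    then show ?thesis by (simp add: * output_jet_def)
  next
    \<comment> \<open>\<open>output_jet\<close> describes the first component up to order 5 only.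
      The sixth derivative is therefore taken of the fifth, known as a function, and evaluated in
      the second component.\<close>
    case False
    with that have k: "k = Suc 5" by simp
    show ?thesis
      unfolding k funpow.simps comp_def *[OF order_refl]
      by (simp add: total_deriv_output_jet[OF assms]) (simp add: output_jet_def)
  qed
qed

section \<open>The Jacobian determinant\<close>

text \<open>The principal minor of \<open>A\<close> on \<open>S\<close>, which avoids changing the index type in expansions.\<close>

definition subdet :: "real^'n^'n::finite \<Rightarrow> 'n set \<Rightarrow> real" where
  "subdet A S = (\<Sum>p | p permutes S. of_int (sign p) * (\<Prod>i\<in>S. A $ i $ p i))"

lemma det_eq_subdet: "det A = subdet A UNIV"
  by (simp add: det_def subdet_def)

text \<open>In the Leibniz formula every permutation that moves \<open>i\<close> meets a zero entry;
  those that fix \<open>i\<close> are the permutations of \<open>S\<close>.\<close>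

lemma subdet_insertI:
  assumes "i \<notin> S"
    and "\<And>p. p permutes insert i S \<Longrightarrow> p i \<noteq> i \<Longrightarrow> \<exists>j\<in>insert i S. A $ j $ p j = 0"
  shows "subdet A (insert i S) = A $ i $ i * subdet A S"
proof -
  have "(\<Sum>p | p permutes insert i S. of_int (sign p) * (\<Prod>i\<in>insert i S. A $ i $ p i))
      = (\<Sum>p | p permutes S. of_int (sign p) * (\<Prod>i\<in>insert i S. A $ i $ p i))"
  proof (rule sum.mono_neutral_right)
    show "{p. p permutes S} \<subseteq> {p. p permutes insert i S}"
      by (auto intro: permutes_subset)
    show "\<forall>p\<in>{p. p permutes insert i S} - {p. p permutes S}.
        of_int (sign p) * (\<Prod>i\<in>insert i S. A $ i $ p i) = 0"
    proof
      fix p assume p: "p \<in> {p. p permutes insert i S} - {p. p permutes S}"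
      then have "p i \<noteq> i"
        using permutes_insert_lemma[of p i S] by auto
      with p assms(2)[of p] have "\<exists>j\<in>insert i S. A $ j $ p j = 0" by blast
      then have "(\<Prod>i\<in>insert i S. A $ i $ p i) = 0" by (intro prod_zero) auto
      then show "of_int (sign p) * (\<Prod>i\<in>insert i S. A $ i $ p i) = 0" by simp
    qed
  qed (simp add: finite_permutations)
  also have "\<dots> = (\<Sum>p | p permutes S. A $ i $ i * (of_int (sign p) * (\<Prod>i\<in>S. A $ i $ p i)))"
    by (rule sum.cong) (use assms(1) in \<open>auto simp: permutes_not_in\<close>)
  finally show ?thesis by (simp add: subdet_def sum_distrib_left)
qed

lemma subdet_insert_row:
  assumes "i \<notin> S" and "\<And>j. j \<in> S \<Longrightarrow> A $ i $ j = 0"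
  shows "subdet A (insert i S) = A $ i $ i * subdet A S"
proof (rule subdet_insertI[OF assms(1)])
  fix p assume "p permutes insert i S" "p i \<noteq> i"
  then have "p i \<in> S" using permutes_in_image[of p "insert i S" i] by auto
  with assms(2) show "\<exists>j\<in>insert i S. A $ j $ p j = 0" by blast
qed

lemma subdet_insert_column:
  assumes "i \<notin> S" and "\<And>j. j \<in> S \<Longrightarrow> A $ j $ i = 0"
  shows "subdet A (insert i S) = A $ i $ i * subdet A S"
proof (rule subdet_insertI[OF assms(1)])
  fix p assume p: "p permutes insert i S" "p i \<noteq> i"
  \<comment> \<open>The row that \<open>p\<close> sends to \<open>i\<close> has its factor in the
    zero column.\<close>
  obtain j where j: "p j = i" "j \<in> insert i S"
    using permutes_image[OF p(1)] by (metis imageE insertI1)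
  with p(2) have "j \<in> S" by auto
  with j(1) assms(2) show "\<exists>j\<in>insert i S. A $ j $ p j = 0" by (metis insertCI)
qed

lemma subdet_3:
  assumes "a \<noteq> b" "a \<noteq> c" "b \<noteq> c"
  shows "subdet A {a, b, c} =
    A$a$a * A$b$b * A$c$c + A$a$b * A$b$c * A$c$a + A$a$c * A$b$a * A$c$b
    - A$a$a * A$b$c * A$c$b - A$a$b * A$b$a * A$c$c - A$a$c * A$b$b * A$c$a"
proof -
  have f: "finite {b, c}" "a \<notin> {b, c}" "finite {c}" "b \<notin> {c}" using assms by auto
  show ?thesis
    unfolding subdet_def sum_over_permutations_insert[OF f(1,2)]
      sum_over_permutations_insert[OF f(3,4)] permutes_sing
    using assms
    by (simp add: sign_swap_id permutation_swap_id sign_compose sign_id swap_id_eq)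
qed

section \<open>The linearizing map in thirteen coordinates\<close>

definition state_part :: "real^13 \<Rightarrow> real^10" where
  "state_part P = vector [P$2, P$3, P$4, P$5, P$6, P$7, P$8, P$9, P$10, P$11]"

definition input_part :: "real^13 \<Rightarrow> nat \<Rightarrow> real^2" where
  "input_part P = Poly_Mapping.lookup (Poly_Mapping.single 0 (vector [P$12, P$13]))"

lemma linearizing_map_nth:
  assumes "g \<noteq> - 1"
  shows "linearizing_map g b1 b2 P $ 1 = P$1"
    and "linearizing_map g b1 b2 P $ 2 = surge_chain g b1 b2 0 (state_part P) (input_part P)"
    and "linearizing_map g b1 b2 P $ 3 = surge_chain g b1 b2 1 (state_part P) (input_part P)"
    and "linearizing_map g b1 b2 P $ 4 = surge_chain g b1 b2 2 (state_part P) (input_part P)"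
    and "linearizing_map g b1 b2 P $ 5 = surge_chain g b1 b2 3 (state_part P) (input_part P)"
    and "linearizing_map g b1 b2 P $ 6 = surge_chain g b1 b2 4 (state_part P) (input_part P)"
    and "linearizing_map g b1 b2 P $ 7 = P$4"
    and "linearizing_map g b1 b2 P $ 8 = P$7"
    and "linearizing_map g b1 b2 P $ 9 = P$8"
    and "linearizing_map g b1 b2 P $ 10 = P$9"
    and "linearizing_map g b1 b2 P $ 11 = P$10"
    and "linearizing_map g b1 b2 P $ 12 = P$11"
    and "linearizing_map g b1 b2 P $ 13 = P$13"
  unfolding linearizing_map_def Let_def vector_13
  by (simp_all only: prolonged_output_derivs(1)[OF assms] prolonged_output_derivs(2)[OF assms])
    (simp_all add: output_jet_def state_part_def input_part_def yaw_chain_def yaw_jet_def vector_10)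

definition yaw_coords :: "real^13 \<Rightarrow> nat \<Rightarrow> real" where
  "yaw_coords P = yaw_jet (state_part P) (input_part P)"

lemma yaw_coords_eq:
  "yaw_coords P i = (if i = 0 then P$7 else if i = 1 then P$8 else if i = 2 then P$9
    else if i = 3 then P$10 else if i = 4 then P$11 else if i = 5 then P$13 else 0)"
  by (auto simp: yaw_coords_def yaw_jet_def state_part_def input_part_def vector_10 lookup_single when_def)

lemma surge_chain_coords:
  "surge_chain g b1 b2 k (state_part P) (input_part P) =
    chain g b2 (yaw_coords P) k (body_xi (P$2) (P$3) (P$4)) (body_eta (P$2) (P$3) (P$4)) (P$6)
      (surge_jet g b1 b2 (state_part P) (input_part P))"
  by (simp add: surge_chain_def yaw_coords_def state_part_def vector_10)

lemma surge_jet_coords: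
  "surge_jet g b1 b2 (state_part P) (input_part P) 0 = P$5"
  "surge_jet g b1 b2 (state_part P) (input_part P) 1 = 1 / g * P$6 * P$7 - b1 * P$5 + P$12"
  by (simp_all add: surge_jet_def state_part_def input_part_def vector_10 lookup_single)

lemma linearizing_map_differentiable:
  assumes "g \<noteq> - 1"
  shows "linearizing_map g b1 b2 differentiable (at P)"
proof (rule smooth_on_differentiable[OF smooth_onI])
  fix n
  have "\<forall>i. Ck_on n UNIV (\<lambda>P. state_part P $ i)"
    by (simp add: forall_10 state_part_def vector_10 Ck_on_vec_nth Ck_on_ident)
  then have X: "Ck_on n UNIV state_part"
    by (intro Ck_on_componentwise) simp_all
  have "\<forall>i. Ck_on n UNIV (\<lambda>P :: real^13. (vector [P$12, P$13] :: real^2) $ i)"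
    by (simp add: forall_2 Ck_on_vec_nth Ck_on_ident)
  then have "Ck_on n UNIV (\<lambda>P :: real^13. vector [P$12, P$13] :: real^2)"
    by (intro Ck_on_componentwise) simp_all
  then have U: "Ck_on n UNIV (\<lambda>P. input_part P i)" for i
    by (cases "i = 0") (simp_all add: input_part_def lookup_single Ck_on_const)
  have "\<forall>i. Ck_on n UNIV (\<lambda>P. linearizing_map g b1 b2 P $ i)"
    unfolding forall_13 linearizing_map_nth[OF assms]
    by (auto intro!: Ck_on_surge_chain X U Ck_on_vec_nth Ck_on_ident)
  then show "Ck_on n UNIV (linearizing_map g b1 b2)"
    by (intro Ck_on_componentwise) simp_all
qed simp

text \<open>Rows that are unit vectors remove the columns of t, \<theta>, r and the derivatives of
  r, so the coefficients are never differentiated with respect to the yaw jet. Of the remaining 5x5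
  minor the triangular shape needs only 18 entries.\<close>

lemma linearizing_map_jacobian:
  assumes "g \<noteq> - 1"
  shows "\<exists>J. (linearizing_map g b1 b2 has_derivative (\<lambda>h. J *v h)) (at P) \<and>
              det J = - Delta g b2 (P$7) (P$8) (P$9)"
proof -
  define D where "D = frechet_derivative (linearizing_map g b1 b2) (at P)"
  define J where "J = matrix D"
  have D: "(linearizing_map g b1 b2 has_derivative D) (at P)"
    using linearizing_map_differentiable[OF assms] by (simp add: D_def frechet_derivative_works)
  then have "(\<lambda>h. J *v h) = D"
    by (simp add: J_def fun_eq_iff matrix_works has_derivative_linear)
  with D have deriv: "(linearizing_map g b1 b2 has_derivative (\<lambda>h. J *v h)) (at P)" by simp
  have JI: "J $ i $ j = d"
    if "((\<lambda>s. linearizing_map g b1 b2 (P + s *\<^sub>R axis j 1) $ i) has_real_derivative d) (at 0)" for i j d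
    using frechet_derivative_nth_line[OF linearizing_map_differentiable[OF assms] that]
    by (simp add: J_def D_def matrix_def)
  note map = linearizing_map_nth[OF assms]
  have unit: "J $ 1 $ j = axis j 1 $ 1" "J $ 7 $ j = axis j 1 $ 4" "J $ 8 $ j = axis j 1 $ 7"
    "J $ 9 $ j = axis j 1 $ 8" "J $ 10 $ j = axis j 1 $ 9" "J $ 11 $ j = axis j 1 $ 10"
    "J $ 12 $ j = axis j 1 $ 11" "J $ 13 $ j = axis j 1 $ 13" for j
    by (rule JI, simp only: map, rule line_has_derivative)+
  define w where "w = yaw_coords P"
  \<comment> \<open>The columns of x, y, u, v and u_1 leave the yaw jet unchanged, so along them all
    coefficients are constants.\<close>
  have w: "yaw_coords (P + s *\<^sub>R axis j 1) = w" if "j \<in> {2, 3, 5, 6, 12}" for j s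
    using that by (auto simp: w_def yaw_coords_eq fun_eq_iff axis_def)
  define \<alpha> \<beta> \<gamma> where "\<alpha> k = coefA g b2 w k 0" and "\<beta> k = coefB g b2 w k 0" and "\<gamma> k = coefC g b2 w k 0" for k
  define \<theta> where "\<theta> = P $ 4"
  have ax: "axis j (1::real) $ i = (if i = j then 1 else 0)" for i j :: 13
    by (simp add: axis_def)
  note defs = surge_chain_coords w chain_def chain_lin_def body_xi_def body_eta_def ax
    \<alpha>_def[symmetric] \<beta>_def[symmetric] \<gamma>_def[symmetric] \<theta>_def[symmetric] surge_jet_coords[unfolded One_nat_def]
  have rows:
    "((\<lambda>s. surge_chain g b1 b2 k (state_part (P + s *\<^sub>R axis 2 1)) (input_part (P + s *\<^sub>R axis 2 1)))
      has_real_derivative \<alpha> k * cos \<theta> - \<beta> k * sin \<theta>) (at 0)"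
    "((\<lambda>s. surge_chain g b1 b2 k (state_part (P + s *\<^sub>R axis 3 1)) (input_part (P + s *\<^sub>R axis 3 1)))
      has_real_derivative \<alpha> k * sin \<theta> + \<beta> k * cos \<theta>) (at 0)"
    "((\<lambda>s. surge_chain g b1 b2 k (state_part (P + s *\<^sub>R axis 6 1)) (input_part (P + s *\<^sub>R axis 6 1)))
      has_real_derivative \<gamma> k) (at 0)"
    "((\<lambda>s. surge_chain g b1 b2 k (state_part (P + s *\<^sub>R axis 5 1)) (input_part (P + s *\<^sub>R axis 5 1)))
      has_real_derivative 0) (at 0)"
    "((\<lambda>s. surge_chain g b1 b2 k (state_part (P + s *\<^sub>R axis 12 1)) (input_part (P + s *\<^sub>R axis 12 1)))
      has_real_derivative 0) (at 0)"
    if "k < 3" for k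
    using that
    by (simp_all add: defs) (auto intro!: derivative_eq_intros simp: algebra_simps)
  have row3:
    "((\<lambda>s. surge_chain g b1 b2 3 (state_part (P + s *\<^sub>R axis 5 1)) (input_part (P + s *\<^sub>R axis 5 1)))
      has_real_derivative residual g b2 w 2 0) (at 0)"
    "((\<lambda>s. surge_chain g b1 b2 3 (state_part (P + s *\<^sub>R axis 12 1)) (input_part (P + s *\<^sub>R axis 12 1)))
      has_real_derivative 0) (at 0)"
    by (simp_all add: defs) (auto intro!: derivative_eq_intros)
  have row4:
    "((\<lambda>s. surge_chain g b1 b2 4 (state_part (P + s *\<^sub>R axis 12 1)) (input_part (P + s *\<^sub>R axis 12 1)))
      has_real_derivative residual g b2 w 2 0) (at 0)"
    by (simp add: defs) (auto intro!: derivative_eq_intros)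
  have entries:
    "J $ 2 $ 2 = \<alpha> 0 * cos \<theta> - \<beta> 0 * sin \<theta>" "J $ 2 $ 3 = \<alpha> 0 * sin \<theta> + \<beta> 0 * cos \<theta>" "J $ 2 $ 6 = \<gamma> 0"
    "J $ 3 $ 2 = \<alpha> 1 * cos \<theta> - \<beta> 1 * sin \<theta>" "J $ 3 $ 3 = \<alpha> 1 * sin \<theta> + \<beta> 1 * cos \<theta>" "J $ 3 $ 6 = \<gamma> 1"
    "J $ 4 $ 2 = \<alpha> 2 * cos \<theta> - \<beta> 2 * sin \<theta>" "J $ 4 $ 3 = \<alpha> 2 * sin \<theta> + \<beta> 2 * cos \<theta>" "J $ 4 $ 6 = \<gamma> 2"
    "J $ 2 $ 5 = 0" "J $ 3 $ 5 = 0" "J $ 4 $ 5 = 0" "J $ 2 $ 12 = 0" "J $ 3 $ 12 = 0" "J $ 4 $ 12 = 0"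
    "J $ 5 $ 5 = residual g b2 w 2 0" "J $ 5 $ 12 = 0" "J $ 6 $ 12 = residual g b2 w 2 0"
    by (rule JI, simp only: map, rule rows row3 row4, simp?)+
  \<comment> \<open>the 8-cycle that sends a column to the row whose pivot it carries\<close>
  define p :: "13 \<Rightarrow> 13" where "p = Transposition.transpose 4 7 \<circ> Transposition.transpose 7 8
    \<circ> Transposition.transpose 8 9 \<circ> Transposition.transpose 9 10 \<circ> Transposition.transpose 10 11
    \<circ> Transposition.transpose 11 12 \<circ> Transposition.transpose 12 6"
  have p: "p permutes UNIV"
    unfolding p_def by (intro permutes_compose permutes_swap_id) auto
  \<comment> \<open>Seven transpositions: this is the minus sign in the result, due only to the
    ordering of coordinates.\<close>
  have "sign p = - 1"
    unfolding p_def by (simp add: sign_compose permutation_compose permutation_swap_id sign_swap_id)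
  then have "det J = - det (\<chi> i. J $ p i)"
    using det_permute_rows[OF p, of J] by simp
  moreover define B where "B = (\<chi> i. J $ p i)"
  ultimately have "det J = - det B" by simp
  have pB: "B $ 1 = J $ 1" "B $ 2 = J $ 2" "B $ 3 = J $ 3" "B $ 6 = J $ 4" "B $ 5 = J $ 5"
    "B $ 12 = J $ 6" "B $ 4 = J $ 7" "B $ 7 = J $ 8" "B $ 8 = J $ 9" "B $ 9 = J $ 10"
    "B $ 10 = J $ 11" "B $ 11 = J $ 12" "B $ 13 = J $ 13"
    by (simp_all add: B_def p_def transpose_def)
  have UNIV_13: "(UNIV :: 13 set) =
      insert 1 (insert 4 (insert 7 (insert 8 (insert 9 (insert 10 (insert 11 (insert 13
        (insert 12 (insert 5 {2, 3, 6})))))))))"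
  proof -
    have "\<forall>i::13. i \<in> insert 1 (insert 4 (insert 7 (insert 8 (insert 9 (insert 10 (insert 11 (insert 13
        (insert 12 (insert 5 {2, 3, 6})))))))))"
      unfolding forall_13 by simp
    then show ?thesis by auto
  qed
  \<comment> \<open>Column 12 is u_1, which occurs first in the fourth derivative, and column 5 is
    u, which occurs first in the third; both pivots are the same residual.\<close>
  have "subdet B (insert 12 (insert 5 {2, 3, 6})) = residual g b2 w 2 0 * (residual g b2 w 2 0 * subdet B {2, 3, 6})"
  proof -
    have "subdet B (insert 12 (insert 5 {2, 3, 6})) = B $ 12 $ 12 * subdet B (insert 5 {2, 3, 6})"
      by (rule subdet_insert_column) (auto simp: pB entries)
    moreover have "subdet B (insert 5 {2, 3, 6}) = B $ 5 $ 5 * subdet B {2, 3, 6}"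
      by (rule subdet_insert_column) (auto simp: pB entries)
    ultimately show ?thesis by (simp add: pB entries)
  qed
  moreover have "subdet B UNIV = subdet B (insert 12 (insert 5 {2, 3, 6}))"
  proof -
    have peel: "subdet B (insert c S) = subdet B S" if "B $ c = axis c 1" "c \<notin> S" for c S
    proof -
      have "subdet B (insert c S) = B $ c $ c * subdet B S"
        by (rule subdet_insert_row) (use that in \<open>auto simp: ax\<close>)
      then show ?thesis by (simp add: that(1) ax)
    qed
    show ?thesis
      unfolding UNIV_13 by (simp add: peel pB unit vec_eq_iff ax)
  qed
  moreover have "subdet B {2, 3, 6} = coef_det g b2 w"
  proof -
    \<comment> \<open>The columns of x and y are those of \<xi> and \<eta> turned by the angle
      \<theta>; a rotation has determinant 1.\<close>
    have "subdet B {2, 3, 6} =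
      \<alpha> 0 * (\<beta> 1 * \<gamma> 2 - \<gamma> 1 * \<beta> 2) - \<beta> 0 * (\<alpha> 1 * \<gamma> 2 - \<gamma> 1 * \<alpha> 2) + \<gamma> 0 * (\<alpha> 1 * \<beta> 2 - \<beta> 1 * \<alpha> 2)"
      by (simp add: subdet_3 pB entries) (use sin_cos_squared_add[of \<theta>] in algebra)
    then show ?thesis by (simp add: coef_det_def \<alpha>_def \<beta>_def \<gamma>_def)
  qed
  ultimately have "det B = coef_det g b2 w * (residual g b2 w 2 0)\<^sup>2"
    by (simp add: det_eq_subdet power2_eq_square)
  also have "\<dots> = Delta g b2 (P$7) (P$8) (P$9)"
    by (simp add: coef_det_residual[OF assms] w_def yaw_coords_eq)
  finally show ?thesis
    using deriv \<open>det J = - det B\<close> by auto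
qed

section \<open>Static feedback linearization of the prolonged vessel\<close>

definition chain_order :: "2 \<Rightarrow> nat" where
  "chain_order c = (if c = 1 then 4 else 6)"

definition chain_label :: "2 \<times> nat \<Rightarrow> 10" where
  "chain_label = (\<lambda>(c, k). if c = 1 then of_nat (k + 1) else of_nat (k + 5))"

definition two_chains :: "(10, 2) system" where
  "two_chains t z w = vector [z$2, z$3, z$4, w$1, z$6, z$7, z$8, z$9, z$10, w$2]"

lemma less_4_6:
  "k < (4::nat) \<longleftrightarrow> k = 0 \<or> k = 1 \<or> k = 2 \<or> k = 3"
  "k < (6::nat) \<longleftrightarrow> k = 0 \<or> k = 1 \<or> k = 2 \<or> k = 3 \<or> k = 4 \<or> k = 5"
  by auto

lemma chain_label_simps:
  "chain_label (1, 0) = 1" "chain_label (1, 1) = 2" "chain_label (1, 2) = 3" "chain_label (1, 3) = 4"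
  "chain_label (2, 0) = 5" "chain_label (2, 1) = 6" "chain_label (2, 2) = 7" "chain_label (2, 3) = 8"
  "chain_label (2, 4) = 9" "chain_label (2, 5) = 10"
  by (simp_all add: chain_label_def)

lemma brunovsky_two_chains: "brunovsky chain_order chain_label two_chains"
  unfolding brunovsky_def
proof
  have "{(c, k). k < chain_order c} =
      {(1, 0), (1, 1), (1, 2), (1, 3), (2, 0), (2, 1), (2, 2), (2, 3), (2, 4), (2, 5)}"
    (is "_ = ?I")
  proof (intro set_eqI iffI)
    fix p assume "p \<in> {(c, k). k < chain_order c}"
    then show "p \<in> ?I"
      using exhaust_2[of "fst p"]
      by (cases p) (auto simp: chain_order_def less_4_6 split: if_splits)
  qed (auto simp: chain_order_def)
  moreover have img: "chain_label ` ?I = UNIV"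
  proof -
    have "\<forall>i. i \<in> chain_label ` ?I"
      unfolding forall_10 image_insert chain_label_simps by simp
    then show ?thesis by blast
  qed
  moreover have "inj_on chain_label ?I"
  proof -
    \<comment> \<open>Ten index pairs cover a type with ten elements, so injectivity follows by
      counting.\<close>
    have "card ?I = CARD(10)" by simp
    then show ?thesis by (intro eq_card_imp_inj_on) (simp, simp only: img)
  qed
  ultimately show "bij_betw chain_label {(c, k). k < chain_order c} UNIV"
    by (simp only: bij_betw_def)
  show "\<forall>t z w c k. k < chain_order c \<longrightarrow> two_chains t z w $ chain_label (c, k) =
      (if Suc k < chain_order c then z $ chain_label (c, Suc k) else w $ c)"
  proof (intro allI impI)
    fix t z w c k assume "k < chain_order c"
    then show "two_chains t z w $ chain_label (c, k) =
        (if Suc k < chain_order c then z $ chain_label (c, Suc k) else w $ c)"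
      using exhaust_2[of c]
      by (auto simp: chain_order_def less_4_6 two_chains_def chain_label_def vector_10)
  qed
qed

section \<open>The feedback transformation and its explicit inverse\<close>

definition chain_state :: "real \<Rightarrow> real \<Rightarrow> real \<Rightarrow> real \<Rightarrow> real^10 \<Rightarrow> real^10" where
  "chain_state g b1 b2 t X = vector
     [surge_chain g b1 b2 0 X (\<lambda>_. 0), surge_chain g b1 b2 1 X (\<lambda>_. 0),
      surge_chain g b1 b2 2 X (\<lambda>_. 0), surge_chain g b1 b2 3 X (\<lambda>_. 0),
      X$3, X$6, X$7, X$8, X$9, X$10]"

text \<open>The zero input in \<open>chain_state\<close> and the constant sequence here are
  placeholders: by \<open>surge_chain_cong\<close> the former is not read at all and the latter only
  in its entry 0. This makes the state map visibly independent of the input.\<close>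

definition chain_input :: "real \<Rightarrow> real \<Rightarrow> real \<Rightarrow> real \<Rightarrow> real^10 \<Rightarrow> real^2 \<Rightarrow> real^2" where
  "chain_input g b1 b2 t X u = vector [surge_chain g b1 b2 4 X (\<lambda>_. u), u$2]"

definition regular_set :: "real \<Rightarrow> real \<Rightarrow> (real \<times> (real^10) \<times> (real^2)) set" where
  "regular_set g b2 = {(t, X, u). quartic g b2 (X$6) (X$7) (X$8) \<noteq> 0}"

definition feedback_map ::
  "real \<Rightarrow> real \<Rightarrow> real \<Rightarrow> real \<times> (real^10) \<times> (real^2) \<Rightarrow> real \<times> (real^10) \<times> (real^2)" where
  "feedback_map g b1 b2 = (\<lambda>(t, X, u). (t, chain_state g b1 b2 t X, chain_input g b1 b2 t X u))"

definition surge_values :: "real^10 \<Rightarrow> real^2 \<Rightarrow> nat \<Rightarrow> real" where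
  "surge_values Z W k =
    (if k = 0 then Z$1 else if k = 1 then Z$2 else if k = 2 then Z$3 else if k = 3 then Z$4 else W$1)"

definition inverse_state :: "real \<Rightarrow> real \<Rightarrow> real^10 \<Rightarrow> real^2 \<Rightarrow> real^10" where
  "inverse_state g b2 Z W =
    (let w = yaw_jet Z (\<lambda>_. W); q = surge_values Z W;
         \<xi> = sol_xi g b2 w q; \<eta> = sol_eta g b2 w q
     in vector [\<xi> * cos (Z$5) - \<eta> * sin (Z$5), \<xi> * sin (Z$5) + \<eta> * cos (Z$5), Z$5,
          sol_u g b2 w q, sol_v g b2 w q, Z$6, Z$7, Z$8, Z$9, Z$10])"

text \<open>Once u' is known, the surge equation is solved for u_1.\<close>

definition inverse_input :: "real \<Rightarrow> real \<Rightarrow> real \<Rightarrow> real^10 \<Rightarrow> real^2 \<Rightarrow> real^2" where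
  "inverse_input g b1 b2 Z W =
    (let w = yaw_jet Z (\<lambda>_. W); q = surge_values Z W
     in vector [sol_du g b2 w q - 1 / g * sol_v g b2 w q * Z$6 + b1 * sol_u g b2 w q, W$2])"

definition feedback_inverse ::
  "real \<Rightarrow> real \<Rightarrow> real \<Rightarrow> real \<times> (real^10) \<times> (real^2) \<Rightarrow> real \<times> (real^10) \<times> (real^2)" where
  "feedback_inverse g b1 b2 = (\<lambda>(t, Z, W). (t, inverse_state g b2 Z W, inverse_input g b1 b2 Z W))"

context
  fixes g b1 b2 :: real
  assumes g: "g \<noteq> 0" "g \<noteq> - 1"
begin

lemma yaw_jet_chain_state:
  "yaw_jet (chain_state g b1 b2 t X) (\<lambda>_. chain_input g b1 b2 t X u) = yaw_jet X (\<lambda>_. u)"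
  by (simp add: fun_eq_iff yaw_jet_def chain_state_def chain_input_def vector_10)

lemma surge_values_chain_state:
  assumes "k \<le> 4"
  shows "surge_values (chain_state g b1 b2 t X) (chain_input g b1 b2 t X u) k
      = surge_chain g b1 b2 k X (\<lambda>_. u)"
proof -
  have "surge_chain g b1 b2 k X (\<lambda>_. 0) = surge_chain g b1 b2 k X (\<lambda>_. u)" if "k < 4" for k
    using that by (intro surge_chain_cong) auto
  with assms show ?thesis
    by (auto simp: surge_values_def chain_state_def chain_input_def vector_10 numeral_eq_Suc le_Suc_eq)
qed

lemma yaw_jet_012:
  "yaw_jet X U 0 = X$6" "yaw_jet X U 1 = X$7" "yaw_jet X U 2 = X$8"
  by (simp_all add: yaw_jet_def)

lemma feedback_inverse_left:
  assumes "p \<in> regular_set g b2"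
  shows "feedback_inverse g b1 b2 (feedback_map g b1 b2 p) = p"
proof -
  obtain t X u where p: "p = (t, X, u)" by (cases p)
  let ?w = "yaw_jet X (\<lambda>_. u)"
    and ?q = "surge_values (chain_state g b1 b2 t X) (chain_input g b1 b2 t X u)"
  have "quartic g b2 (?w 0) (?w 1) (?w 2) \<noteq> 0"
    using assms by (simp only: yaw_jet_012) (simp add: p regular_set_def)
  note reg = chain_regular[OF g this]
  note sol = chain_inject[OF reg, of ?q, OF surge_values_chain_state[unfolded surge_chain_def]]
  have "inverse_state g b2 (chain_state g b1 b2 t X) (chain_input g b1 b2 t X u) = X"
    unfolding inverse_state_def Let_def yaw_jet_chain_state
    by (simp only: sol) (simp add: vec_eq_iff forall_10 vector_10 chain_state_def earth_body surge_jet_def)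
  moreover have "inverse_input g b1 b2 (chain_state g b1 b2 t X) (chain_input g b1 b2 t X u) = u"
    unfolding inverse_input_def Let_def yaw_jet_chain_state
    by (simp only: sol) (simp add: vec_eq_iff forall_2 vector_10 chain_state_def chain_input_def surge_jet_def)
  ultimately show ?thesis by (simp add: p feedback_map_def feedback_inverse_def)
qed

text \<open>Together with invariance of the regular set under the inverse, this identifies the
  image, which has to be open.\<close>

lemma feedback_inverse_right:
  assumes "p \<in> regular_set g b2"
  shows "feedback_map g b1 b2 (feedback_inverse g b1 b2 p) = p"
proof -
  obtain t Z W where p: "p = (t, Z, W)" by (cases p)
  let ?w = "yaw_jet Z (\<lambda>_. W)" and ?q = "surge_values Z W"
  define X u where "X = inverse_state g b2 Z W" and "u = inverse_input g b1 b2 Z W"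
  have "quartic g b2 (?w 0) (?w 1) (?w 2) \<noteq> 0"
    using assms by (simp only: yaw_jet_012) (simp add: p regular_set_def)
  note reg = chain_regular[OF g this]
  have X: "X$1 = sol_xi g b2 ?w ?q * cos (Z$5) - sol_eta g b2 ?w ?q * sin (Z$5)"
    "X$2 = sol_xi g b2 ?w ?q * sin (Z$5) + sol_eta g b2 ?w ?q * cos (Z$5)" "X$3 = Z$5"
    "X$4 = sol_u g b2 ?w ?q" "X$5 = sol_v g b2 ?w ?q"
    "X$6 = Z$6" "X$7 = Z$7" "X$8 = Z$8" "X$9 = Z$9" "X$10 = Z$10"
    by (simp_all add: X_def inverse_state_def Let_def vector_10)
  have u: "u$1 = sol_du g b2 ?w ?q - 1 / g * sol_v g b2 ?w ?q * Z$6 + b1 * sol_u g b2 ?w ?q"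
    "u$2 = W$2"
    by (simp_all add: u_def inverse_input_def Let_def)
  have "yaw_jet X (\<lambda>_. u) = ?w"
    by (simp add: fun_eq_iff yaw_jet_def X u)
  then have chain: "surge_chain g b1 b2 k X (\<lambda>_. u) = ?q k" if "k \<le> 4" for k
    unfolding surge_chain_def
    by (simp add: X earth_body chain_surject[OF reg _ _ that] surge_jet_def u)
  have "surge_chain g b1 b2 k X (\<lambda>_. 0) = ?q k" if "k < 4" for k
    using chain[of k] surge_chain_cong[of k "\<lambda>_. 0" "\<lambda>_. u" g b1 b2 X] that by simp
  then have "chain_state g b1 b2 t X = Z"
    by (simp add: vec_eq_iff forall_10 vector_10 chain_state_def X surge_values_def)
  moreover have "chain_input g b1 b2 t X u = W"
    by (simp add: vec_eq_iff forall_2 chain_input_def u chain surge_values_def)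
  ultimately show ?thesis
    by (simp add: p feedback_map_def feedback_inverse_def X_def u_def)
qed

text \<open>Q depends on r and its first two derivatives only, and these keep their positions 6, 7,
  8 under the transformation.\<close>

lemma feedback_map_regular: "feedback_map g b1 b2 p \<in> regular_set g b2 \<longleftrightarrow> p \<in> regular_set g b2"
  by (cases p) (simp add: feedback_map_def regular_set_def chain_state_def vector_10)

lemma feedback_inverse_regular:
  "p \<in> regular_set g b2 \<Longrightarrow> feedback_inverse g b1 b2 p \<in> regular_set g b2"
  by (cases p) (simp add: feedback_inverse_def regular_set_def inverse_state_def Let_def vector_10)

lemma feedback_map_image: "feedback_map g b1 b2 ` regular_set g b2 = regular_set g b2"
proof -
  have "p \<in> feedback_map g b1 b2 ` regular_set g b2" if "p \<in> regular_set g b2" for p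
    using feedback_inverse_right[OF that] feedback_inverse_regular[OF that] by (metis imageI)
  then show ?thesis using feedback_map_regular by auto
qed

lemma feedback_map_inj: "inj_on (feedback_map g b1 b2) (regular_set g b2)"
  by (rule inj_on_inverseI[where g = "feedback_inverse g b1 b2"]) (rule feedback_inverse_left)

lemma open_regular_set: "open (regular_set g b2)"
proof -
  have "Ck_on 0 UNIV (\<lambda>p :: real \<times> (real^10) \<times> (real^2).
      quartic g b2 (fst (snd p) $ 6) (fst (snd p) $ 7) (fst (snd p) $ 8))"
    unfolding quartic_def
    by (intro Ck_on_add Ck_on_diff Ck_on_mult Ck_on_power Ck_on_const Ck_on_vec_nth Ck_on_fst
        Ck_on_snd Ck_on_ident open_UNIV)
  then have "open {p :: real \<times> (real^10) \<times> (real^2).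
      quartic g b2 (fst (snd p) $ 6) (fst (snd p) $ 7) (fst (snd p) $ 8) \<noteq> 0}"
    by (intro open_Collect_neq) (simp_all add: continuous_on_const)
  moreover have "regular_set g b2 = {p. quartic g b2 (fst (snd p) $ 6) (fst (snd p) $ 7)
      (fst (snd p) $ 8) \<noteq> 0}"
    by (auto simp: regular_set_def)
  ultimately show ?thesis by (simp only:)
qed

lemma smooth_feedback_map: "open S \<Longrightarrow> smooth_on S (feedback_map g b1 b2)"
proof (rule smooth_onI)
  fix n assume S: "open S"
  have X: "Ck_on n S (\<lambda>p :: real \<times> (real^10) \<times> (real^2). fst (snd p))"
    and u: "Ck_on n S (\<lambda>p :: real \<times> (real^10) \<times> (real^2). snd (snd p))"
    by (intro Ck_on_fst Ck_on_snd Ck_on_ident S)+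
  have "\<forall>i. Ck_on n S (\<lambda>p. chain_state g b1 b2 (fst p) (fst (snd p)) $ i)"
    unfolding forall_10 chain_state_def vector_10
    by (auto intro!: Ck_on_surge_chain Ck_on_vec_nth Ck_on_const X S)
  moreover have "\<forall>i. Ck_on n S (\<lambda>p. chain_input g b1 b2 (fst p) (fst (snd p)) (snd (snd p)) $ i)"
    unfolding forall_2 chain_input_def vector_2
    by (auto intro!: Ck_on_surge_chain Ck_on_vec_nth X u S)
  ultimately show "Ck_on n S (feedback_map g b1 b2)"
    unfolding feedback_map_def case_prod_beta
    by (intro Ck_on_Pair Ck_on_fst Ck_on_ident Ck_on_componentwise S) simp_all
qed

lemma smooth_feedback_inverse: "smooth_on (regular_set g b2) (feedback_inverse g b1 b2)"
proof (rule smooth_onI)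
  fix n
  let ?S = "regular_set g b2"
  note S = open_regular_set
  have Z: "Ck_on n ?S (\<lambda>p. fst (snd p) $ i)" and W: "Ck_on n ?S (\<lambda>p. snd (snd p) $ j)" for i j
    by (intro Ck_on_vec_nth Ck_on_fst Ck_on_snd Ck_on_ident S)+
  have w: "Ck_on n ?S (\<lambda>p. yaw_jet (fst (snd p)) (\<lambda>_. snd (snd p)) i)" for i
    by (intro Ck_on_yaw_jet Ck_on_fst Ck_on_snd Ck_on_ident S)
  have q: "Ck_on n ?S (\<lambda>p. surge_values (fst (snd p)) (snd (snd p)) i)" for i
    unfolding surge_values_def
    by (cases "i = 0"; cases "i = 1"; cases "i = 2"; cases "i = 3") (simp_all add: Z W)
  have "quartic g b2 (yaw_jet (fst (snd p)) (\<lambda>_. snd (snd p)) 0)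
      (yaw_jet (fst (snd p)) (\<lambda>_. snd (snd p)) 1) (yaw_jet (fst (snd p)) (\<lambda>_. snd (snd p)) 2) \<noteq> 0"
    if "p \<in> ?S" for p
    using that unfolding yaw_jet_012 by (auto simp: regular_set_def)
  note sol = Ck_on_sol[where w = "\<lambda>p. yaw_jet (fst (snd p)) (\<lambda>_. snd (snd p))" and
      q = "\<lambda>p. surge_values (fst (snd p)) (snd (snd p))", OF S w q chain_regular[OF g this]]
  have "\<forall>i. Ck_on n ?S (\<lambda>p. inverse_state g b2 (fst (snd p)) (snd (snd p)) $ i)"
    unfolding forall_10 inverse_state_def Let_def vector_10
    by (intro conjI Ck_on_add Ck_on_diff Ck_on_mult Ck_on_sin Ck_on_cos sol Z S)
  moreover have "\<forall>i. Ck_on n ?S (\<lambda>p. inverse_input g b1 b2 (fst (snd p)) (snd (snd p)) $ i)"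
    unfolding forall_2 inverse_input_def Let_def vector_2
    by (intro conjI Ck_on_add Ck_on_diff Ck_on_mult Ck_on_const sol Z W S)
  ultimately show "Ck_on n ?S (feedback_inverse g b1 b2)"
    unfolding feedback_inverse_def case_prod_beta
    by (intro Ck_on_Pair Ck_on_fst Ck_on_ident Ck_on_componentwise S) simp_all
qed

lemma chain_state_differentiable:
  "(\<lambda>(t, X). chain_state g b1 b2 t X) differentiable (at p)"
proof (rule smooth_on_differentiable[OF smooth_onI])
  fix n
  have X: "Ck_on n UNIV (\<lambda>p :: real \<times> (real^10). snd p)"
    by (intro Ck_on_snd Ck_on_ident open_UNIV)
  have "\<forall>i. Ck_on n UNIV (\<lambda>p :: real \<times> (real^10). chain_state g b1 b2 (fst p) (snd p) $ i)"
    unfolding forall_10 chain_state_def vector_10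
    by (auto intro!: Ck_on_surge_chain Ck_on_vec_nth Ck_on_const X)
  then show "Ck_on n UNIV (\<lambda>(t, X). chain_state g b1 b2 t X)"
    unfolding case_prod_beta by (intro Ck_on_componentwise) simp_all
qed simp

lemma chain_state_transport:
  "frechet_derivative (\<lambda>(t, X). chain_state g b1 b2 t X) (at (t, X)) (1, prolonged_vessel g b1 b2 t X u)
    = two_chains t (chain_state g b1 b2 t X) (chain_input g b1 b2 t X u)"
proof -
  \<comment> \<open>The input is frozen along the line, its derivatives being set to zero; this is
    harmless because the state map reads no input.\<close>
  let ?X = "\<lambda>s. X + s *\<^sub>R prolonged_vessel g b1 b2 t X u"
    and ?U = "\<lambda>(s::real) k. if k = (0::nat) then u else 0"
  have X: "((\<lambda>s. ?X s $ i) has_real_derivative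
      prolonged_vessel g b1 b2 0 (?X 0) (?U 0 0) $ i) (at 0)" for i
    using line_has_derivative[of X "prolonged_vessel g b1 b2 t X u" i]
    by (simp add: prolonged_vessel_def)
  have U: "((\<lambda>s. ?U s k $ i) has_real_derivative ?U 0 (Suc k) $ i) (at 0)" for i k
    by simp
  have surge: "((\<lambda>s. surge_chain g b1 b2 k (?X s) (\<lambda>_. 0)) has_real_derivative
      surge_chain g b1 b2 (Suc k) X (\<lambda>_. u)) (at 0)" if "k < 4" for k
  proof -
    have "surge_chain g b1 b2 k Y (\<lambda>_. 0) = surge_chain g b1 b2 k Y (?U 0)" for Y
      by (rule surge_chain_cong) (use that in auto)
    moreover have "surge_chain g b1 b2 (Suc k) X (\<lambda>_. u) = surge_chain g b1 b2 (Suc k) X (?U 0)"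
      by (rule surge_chain_cong) (use that in auto)
    ultimately show ?thesis
      using surge_chain_has_derivative[of ?X g b1 b2 0 ?U k, OF X U g(2)] that by simp
  qed
  have surge': "((\<lambda>s. surge_chain g b1 b2 k (?X s) (\<lambda>_. 0)) has_real_derivative
      surge_chain g b1 b2 (Suc k) X (\<lambda>_. 0)) (at 0)" if "k < 3" for k
    using surge[of k] surge_chain_cong[of "Suc k" "\<lambda>_. 0" "\<lambda>_. u" g b1 b2 X] that by simp
  have "\<forall>i. ((\<lambda>s. chain_state g b1 b2 (t + s) (?X s) $ i) has_real_derivative
      two_chains t (chain_state g b1 b2 t X) (chain_input g b1 b2 t X u) $ i) (at 0)"
    unfolding forall_10 two_chains_def chain_state_def chain_input_def vector_10 vector_2
    using surge'[of 0] surge'[of 1] surge'[of 2] surge[of 3]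
      X[of 3] X[of 6] X[of 7] X[of 8] X[of 9] X[of 10]
    by (simp add: prolonged_vessel_nth numeral_eq_Suc)
  then show ?thesis
    by (auto simp: vec_eq_iff intro!: frechet_derivative_nth_line chain_state_differentiable)
qed

text \<open>Having an explicit inverse, the transformation is a diffeomorphism of the whole regular
  set onto itself, so this one set serves as neighbourhood of every point.\<close>

lemma static_feedback_on_regular:
  "static_feedback_on (regular_set g b2) (prolonged_vessel g b1 b2) two_chains
     (chain_state g b1 b2) (chain_input g b1 b2)"
proof -
  have "smooth_on (regular_set g b2) (inv_into (regular_set g b2) (feedback_map g b1 b2))"
  proof (rule smooth_onI)
    fix n
    show "Ck_on n (regular_set g b2) (inv_into (regular_set g b2) (feedback_map g b1 b2))"
    proof (rule Ck_on_cong[OF open_regular_set])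
      show "Ck_on n (regular_set g b2) (feedback_inverse g b1 b2)"
        by (rule smooth_onD[OF smooth_feedback_inverse])
      fix p assume p: "p \<in> regular_set g b2"
      show "feedback_inverse g b1 b2 p = inv_into (regular_set g b2) (feedback_map g b1 b2) p"
        by (rule sym, rule inv_into_f_eq[OF feedback_map_inj])
          (simp_all add: p feedback_inverse_regular feedback_inverse_right)
    qed
  qed
  then show ?thesis
    unfolding static_feedback_on_def feedback_map_def[symmetric] Let_def feedback_map_image
    using open_regular_set smooth_feedback_map[OF open_regular_set] feedback_map_inj
      chain_state_transport by auto
qed

lemma generates_chains_on_regular:
  "generates_chains_on (regular_set g b2) (prolonged_vessel g b1 b2) (prolonged_output g b2) chain_order"
  unfolding generates_chains_on_def
proof (intro exI conjI allI impI)
  fix t X U c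
  let ?D = "\<lambda>k. (total_deriv (prolonged_vessel g b1 b2) ^^ k) (prolonged_output g b2) (t, X, U)"
  have D1: "?D k $ 1 = surge_chain g b1 b2 k X (Poly_Mapping.lookup U)" if "k \<le> 4" for k
    using that by (simp add: prolonged_output_derivs(1)[OF g(2)] output_jet_def)
  have D2: "?D k $ 2 = yaw_chain k X (Poly_Mapping.lookup U)" if "k \<le> 6" for k
    using that by (rule prolonged_output_derivs(2)[OF g(2)])
  have surge: "surge_chain g b1 b2 k X (Poly_Mapping.lookup U) = surge_chain g b1 b2 k X (\<lambda>_. 0)"
    if "k < 4" for k
    by (rule surge_chain_cong) (use that in auto)
  have surge4: "surge_chain g b1 b2 4 X (Poly_Mapping.lookup U)
      = surge_chain g b1 b2 4 X (\<lambda>_. Poly_Mapping.lookup U 0)"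
    by (rule surge_chain_cong) auto
  {
    fix k assume k: "k < chain_order c"
    consider "c = 1" "k < 4" | "c = 2" "k < 6"
      using k exhaust_2[of c] by (auto simp: chain_order_def)
    then show "?D k $ c = chain_state g b1 b2 t X $ chain_label (c, k)"
    proof cases
      case 1
      then have "?D k $ c = surge_chain g b1 b2 k X (\<lambda>_. 0)" by (simp add: D1 surge)
      with 1 show ?thesis by (auto simp: less_4_6 chain_state_def chain_label_def vector_10)
    next
      case 2
      then have "?D k $ c = yaw_chain k X (Poly_Mapping.lookup U)" by (simp add: D2)
      with 2 show ?thesis
        by (auto simp: less_4_6 chain_state_def chain_label_def vector_10 yaw_chain_def yaw_jet_def)
    qed
  }
  show "?D (chain_order c) $ c = chain_input g b1 b2 t X (Poly_Mapping.lookup U 0) $ c"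
    using exhaust_2[of c]
    by (auto simp: chain_order_def D1 D2 surge4 yaw_chain_def yaw_jet_def chain_input_def)
qed (rule brunovsky_two_chains static_feedback_on_regular)+

end

section \<open>Derivatives of curves\<close>

lemma Ck_on_curve_SucI:
  fixes c :: "real \<Rightarrow> 'a::real_normed_vector"
  assumes "open I" and "\<And>t. t \<in> I \<Longrightarrow> (c has_vector_derivative c' t) (at t)" and "Ck_on k I c'"
  shows "Ck_on (Suc k) I c"
proof (rule Ck_on_SucI[OF \<open>open I\<close>])
  show "(c has_derivative (\<lambda>h. h *\<^sub>R c' t)) (at t)" if "t \<in> I" for t
    using assms(2)[OF that] by (simp add: has_vector_derivative_def)
  show "Ck_on k I (\<lambda>t. h *\<^sub>R c' t)" for h
    by (rule Ck_on_bounded_linear[OF assms(1) bounded_linear_scaleR_right assms(3)])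
qed

lemma smooth_on_vector_derivative:
  fixes c :: "real \<Rightarrow> 'a::real_normed_vector"
  assumes "open I" and "smooth_on I c"
  shows "smooth_on I (\<lambda>t. vector_derivative c (at t))"
    and "t \<in> I \<Longrightarrow> (c has_vector_derivative vector_derivative c (at t)) (at t)"
proof -
  show D: "(c has_vector_derivative vector_derivative c (at t)) (at t)" if "t \<in> I" for t
    using smooth_on_differentiable[OF assms(2) that] by (simp add: vector_derivative_works)
  show "smooth_on I (\<lambda>t. vector_derivative c (at t))"
  proof (rule smooth_onI, rule Ck_on_cong[OF \<open>open I\<close>])
    show "frechet_derivative c (at t) 1 = vector_derivative c (at t)" if "t \<in> I" for t
      using D[OF that, unfolded has_vector_derivative_def, THEN frechet_derivative_eqI] by simp
    show "Ck_on k I (\<lambda>t. frechet_derivative c (at t) 1)" for k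
      using smooth_onD[OF assms(2), of "Suc k"] by simp
  qed
qed

lemma nth_vector_derivative_0: "nth_vector_derivative 0 c = c"
  and nth_vector_derivative_Suc:
    "nth_vector_derivative (Suc k) c = (\<lambda>t. vector_derivative (nth_vector_derivative k c) (at t))"
  by (simp_all add: nth_vector_derivative_def)

lemma smooth_on_nth_vector_derivative:
  assumes "open I" and "smooth_on I c"
  shows "smooth_on I (nth_vector_derivative k c)"
  using assms
  by (induction k)
    (simp_all add: nth_vector_derivative_0 nth_vector_derivative_Suc smooth_on_vector_derivative(1))

lemma nth_vector_derivative_has_derivative:
  assumes "open I" and "smooth_on I c" and "t \<in> I"
  shows "(nth_vector_derivative k c has_vector_derivative nth_vector_derivative (Suc k) c t) (at t)"
  unfolding nth_vector_derivative_Suc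
  by (rule smooth_on_vector_derivative(2)[OF assms(1) smooth_on_nth_vector_derivative]) (rule assms)+

text \<open>Smoothness of \<open>y\<close> provides the derivatives of the vector-valued curve; on
  the open set \<open>I\<close> uniqueness of derivatives then matches one component with the
  candidates, order by order.\<close>

lemma nth_vector_derivative_nth_eq:
  fixes y :: "real \<Rightarrow> real^'n::finite"
  assumes "open I" and "smooth_on I y" and "\<And>t. t \<in> I \<Longrightarrow> F 0 t = y t $ i"
    and "\<And>k t. k < n \<Longrightarrow> t \<in> I \<Longrightarrow> (F k has_real_derivative F (Suc k) t) (at t)"
    and "k \<le> n" and "t \<in> I"
  shows "nth_vector_derivative k y t $ i = F k t"
  using \<open>k \<le> n\<close> \<open>t \<in> I\<close>
proof (induction k arbitrary: t)
  case 0
  then show ?case by (simp add: nth_vector_derivative_0 assms(3))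
next
  case (Suc k)
  have "((\<lambda>s. nth_vector_derivative k y s $ i) has_vector_derivative
      nth_vector_derivative (Suc k) y t $ i) (at t)"
    by (rule bounded_linear.has_vector_derivative[OF bounded_linear_vec_nth])
      (rule nth_vector_derivative_has_derivative[OF assms(1,2) Suc.prems(2)])
  then have "(F k has_vector_derivative nth_vector_derivative (Suc k) y t $ i) (at t)"
    by (rule has_vector_derivative_transform_within_open[OF _ assms(1) Suc.prems(2)])
      (use Suc in simp)
  moreover have "(F k has_real_derivative F (Suc k) t) (at t)"
    using Suc.prems by (intro assms(4)) simp_all
  ultimately show ?case
    by (metis DERIV_unique has_real_derivative_iff_has_vector_derivative)
qed

lemma lookup_curve_jet:
  "Poly_Mapping.lookup (curve_jet p c t) k = (if k \<le> p then nth_vector_derivative k c t else 0)"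
  by (simp add: curve_jet_def lookup_sum lookup_single when_def)


section \<open>The flat output of the vessel\<close>

lemma vessel_nth:
  "vessel g c2 b1 b2 b3 t X U $ 1 = X$4 * cos (X$3) - X$5 * sin (X$3)"
  "vessel g c2 b1 b2 b3 t X U $ 2 = X$4 * sin (X$3) + X$5 * cos (X$3)"
  "vessel g c2 b1 b2 b3 t X U $ 3 = X$6"
  "vessel g c2 b1 b2 b3 t X U $ 4 = 1 / g * X$5 * X$6 - b1 * X$4 + U$1"
  "vessel g c2 b1 b2 b3 t X U $ 5 = - g * X$4 * X$6 - b2 * X$5"
  "vessel g c2 b1 b2 b3 t X U $ 6 = c2 * X$4 * X$5 - b3 * X$6 + U$2"
  by (simp_all add: vessel_def Let_def vector_6)

section \<open>The first two derivatives of the yaw rate in terms of the original vessel\<close>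

definition yaw_accel :: "real \<Rightarrow> real \<Rightarrow> real^6 \<Rightarrow> real^2 \<Rightarrow> real" where
  "yaw_accel c2 b3 X u = u$2 + c2 * X$4 * X$5 - b3 * X$6"

definition yaw_jerk ::
  "real \<Rightarrow> real \<Rightarrow> real \<Rightarrow> real \<Rightarrow> real \<Rightarrow> real^6 \<Rightarrow> real^2 \<Rightarrow> real^2 \<Rightarrow> real" where
  "yaw_jerk g c2 b1 b2 b3 X u u' = u'$2
    + c2 * ((1 / g * X$5 * X$6 - b1 * X$4 + u$1) * X$5 + X$4 * (- g * X$4 * X$6 - b2 * X$5))
    - b3 * yaw_accel c2 b3 X u"

text \<open>Serves both for the total derivative that defines the regular set and along
  trajectories, where it yields the second derivative of r.\<close>

lemma yaw_accel_has_derivative: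
  assumes X: "\<And>i. ((\<lambda>s. X s $ i) has_real_derivative
      vessel g c2 b1 b2 b3 t (X t) (u t) $ i) (at t)"
    and u: "((\<lambda>s. u s $ 2) has_real_derivative u' $ 2) (at t)"
  shows "((\<lambda>s. yaw_accel c2 b3 (X s) (u s)) has_real_derivative
      yaw_jerk g c2 b1 b2 b3 (X t) (u t) u') (at t)"
  unfolding yaw_accel_def
  by (rule DERIV_cong, (rule DERIV_add DERIV_diff DERIV_cmult DERIV_mult' X u)+)
    (simp add: vessel_nth yaw_jerk_def yaw_accel_def algebra_simps)

lemma ubar2_eq: "ubar2 c2 b3 (t, X, U) = yaw_accel c2 b3 X (Poly_Mapping.lookup U 0)"
  by (simp add: ubar2_def yaw_accel_def)

lemma ubar2_differentiable: "ubar2 c2 b3 differentiable (at j)"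
proof (rule smooth_on_differentiable[OF smooth_onI])
  show "Ck_on n UNIV (ubar2 c2 b3)" for n
    unfolding ubar2_def case_prod_beta
    by (intro Ck_on_add Ck_on_diff Ck_on_mult Ck_on_const Ck_on_vec_nth Ck_on_lookup Ck_on_fst
        Ck_on_snd Ck_on_ident open_UNIV)
qed simp

lemma total_deriv_ubar2:
  "total_deriv (vessel g c2 b1 b2 b3) (ubar2 c2 b3) (t, X, U)
    = yaw_jerk g c2 b1 b2 b3 X (Poly_Mapping.lookup U 0) (Poly_Mapping.lookup U 1)"
proof (rule total_deriv_line[OF bounded_linear_ident ubar2_differentiable])
  let ?V = "vessel g c2 b1 b2 b3 t X (Poly_Mapping.lookup U 0)"
  let ?X = "\<lambda>s. X + s *\<^sub>R ?V"
    and ?U = "\<lambda>s. Poly_Mapping.lookup (U + s *\<^sub>R Poly_Mapping.map_key Suc U) 0"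
  have X: "((\<lambda>s. ?X s $ i) has_real_derivative
      vessel g c2 b1 b2 b3 0 (?X 0) (?U 0) $ i) (at 0)" for i
    using line_has_derivative[of X ?V i] by (simp add: vessel_def)
  show "((\<lambda>s. ubar2 c2 b3 (t + s, ?X s, U + s *\<^sub>R Poly_Mapping.map_key Suc U)) has_real_derivative
      yaw_jerk g c2 b1 b2 b3 X (Poly_Mapping.lookup U 0) (Poly_Mapping.lookup U 1)) (at 0)"
    using yaw_accel_has_derivative[of ?X g c2 b1 b2 b3 0 ?U, OF X lookup_line_has_derivative]
    by (simp add: ubar2_eq)
qed

lemma vessel_regular_eq:
  assumes "g \<noteq> 0" and "g \<noteq> - 1"
  shows "(t, X, U) \<in> vessel_regular g c2 b1 b2 b3 \<longleftrightarrow>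
    quartic g b2 (X$6) (yaw_accel c2 b3 X (Poly_Mapping.lookup U 0))
      (yaw_jerk g c2 b1 b2 b3 X (Poly_Mapping.lookup U 0) (Poly_Mapping.lookup U 1)) \<noteq> 0"
  by (simp add: vessel_regular_def Delta_nonzero_iff[OF assms] ubar2_eq total_deriv_ubar2)

lemma open_vessel_regular:
  assumes "g \<noteq> 0" and "g \<noteq> - 1"
  shows "open (vessel_regular g c2 b1 b2 b3)"
proof -
  let ?F = "\<lambda>j :: (6, 2) jet. quartic g b2 (fst (snd j) $ 6)
    (yaw_accel c2 b3 (fst (snd j)) (Poly_Mapping.lookup (snd (snd j)) 0))
    (yaw_jerk g c2 b1 b2 b3 (fst (snd j)) (Poly_Mapping.lookup (snd (snd j)) 0)
      (Poly_Mapping.lookup (snd (snd j)) 1))"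
  have "Ck_on 0 UNIV ?F"
    unfolding quartic_def yaw_accel_def yaw_jerk_def
    by (intro Ck_on_add Ck_on_diff Ck_on_mult Ck_on_power Ck_on_const Ck_on_uminus Ck_on_vec_nth
        Ck_on_lookup Ck_on_fst Ck_on_snd Ck_on_ident open_UNIV)
  then have "open {j. ?F j \<noteq> 0}"
    by (intro open_Collect_neq) (simp_all add: continuous_on_const)
  moreover have "vessel_regular g c2 b1 b2 b3 = {j. ?F j \<noteq> 0}"
    using vessel_regular_eq[OF assms] by auto
  ultimately show ?thesis by (simp only:)
qed

text \<open>Entries from index 2 on are never used.\<close>

definition vessel_yaw_jet :: "real \<Rightarrow> real \<Rightarrow> real^6 \<Rightarrow> real^2 \<Rightarrow> nat \<Rightarrow> real" where
  "vessel_yaw_jet c2 b3 X u i = (if i = 0 then X$6 else yaw_accel c2 b3 X u)"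

lemma vessel_output_nth:
  assumes "g \<noteq> - 1"
  shows "vessel_output g c2 b2 b3 (t, X, U) $ 1 =
      chain g b2 (vessel_yaw_jet c2 b3 X (Poly_Mapping.lookup U 0)) 0
        (body_xi (X$1) (X$2) (X$3)) (body_eta (X$1) (X$2) (X$3)) (X$5) (\<lambda>_. 0)"
    and "vessel_output g c2 b2 b3 (t, X, U) $ 2 = X$3"
  by (simp_all add: vessel_output_def ubar2_eq
      output1_eq_chain[OF assms, of "vessel_yaw_jet c2 b3 X (Poly_Mapping.lookup U 0)" _ _ _ _ _ _ _ "\<lambda>_. 0"]
      vessel_yaw_jet_def)

lemma Ck_on_vessel_output:
  assumes "g \<noteq> - 1" and S: "open S" and X: "Ck_on n S X" and U: "Ck_on n S (\<lambda>x. Poly_Mapping.lookup (U x) 0)"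
  shows "Ck_on n S (\<lambda>x. vessel_output g c2 b2 b3 (t x, X x, U x))"
proof -
  have "Ck_on n S (\<lambda>x. yaw_accel c2 b3 (X x) (Poly_Mapping.lookup (U x) 0))"
    unfolding yaw_accel_def
    by (intro Ck_on_add Ck_on_diff Ck_on_mult Ck_on_const Ck_on_vec_nth X U S)
  then have "Ck_on n S (\<lambda>x. vessel_yaw_jet c2 b3 (X x) (Poly_Mapping.lookup (U x) 0) i)" for i
    by (cases "i = 0") (simp_all add: vessel_yaw_jet_def Ck_on_vec_nth X S)
  then have "\<forall>i. Ck_on n S (\<lambda>x. vessel_output g c2 b2 b3 (t x, X x, U x) $ i)"
    unfolding forall_2 vessel_output_nth[OF assms(1)]
    by (intro conjI Ck_on_chain Ck_on_body Ck_on_vec_nth Ck_on_const X S)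
  then show ?thesis by (intro Ck_on_componentwise S) simp
qed

text \<open>The index is raised by one because the second output is \<theta> and r is its
  derivative.\<close>

definition output_yaw :: "(nat \<Rightarrow>\<^sub>0 real^2) \<Rightarrow> nat \<Rightarrow> real" where
  "output_yaw q i = Poly_Mapping.lookup q (Suc i) $ 2"

definition output_surge :: "(nat \<Rightarrow>\<^sub>0 real^2) \<Rightarrow> nat \<Rightarrow> real" where
  "output_surge q k = Poly_Mapping.lookup q k $ 1"

definition flat_domain :: "real \<Rightarrow> real \<Rightarrow> (nat \<Rightarrow>\<^sub>0 real^2) set" where
  "flat_domain g b2 = {q. quartic g b2 (output_yaw q 0) (output_yaw q 1) (output_yaw q 2) \<noteq> 0}"

definition flat_state :: "real \<Rightarrow> real \<Rightarrow> (nat \<Rightarrow>\<^sub>0 real^2) \<Rightarrow> real^6" where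
  "flat_state g b2 q =
    (let w = output_yaw q; p = output_surge q; \<theta> = Poly_Mapping.lookup q 0 $ 2;
         \<xi> = sol_xi g b2 w p; \<eta> = sol_eta g b2 w p
     in vector [\<xi> * cos \<theta> - \<eta> * sin \<theta>, \<xi> * sin \<theta> + \<eta> * cos \<theta>, \<theta>,
          sol_u g b2 w p, sol_v g b2 w p, w 0])"

text \<open>Both inputs come from solving a velocity equation: that of u for u_1 and that of r for
  u_2.\<close>

definition flat_input :: "real \<Rightarrow> real \<Rightarrow> real \<Rightarrow> real \<Rightarrow> real \<Rightarrow> (nat \<Rightarrow>\<^sub>0 real^2) \<Rightarrow> real^2" where
  "flat_input g c2 b1 b2 b3 q =
    (let w = output_yaw q; p = output_surge q
     in vector [sol_du g b2 w p - 1 / g * sol_v g b2 w p * w 0 + b1 * sol_u g b2 w p,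
          w 1 - c2 * sol_u g b2 w p * sol_v g b2 w p + b3 * w 0])"

lemma Ck_on_output_jets:
  assumes "open S"
  shows "Ck_on n S (\<lambda>q. output_yaw q i)" and "Ck_on n S (\<lambda>q. output_surge q i)"
  unfolding output_yaw_def output_surge_def
  by (intro Ck_on_vec_nth Ck_on_lookup Ck_on_ident assms)+

lemma open_flat_domain: "open (flat_domain g b2)"
proof -
  have "Ck_on 0 UNIV (\<lambda>q. quartic g b2 (output_yaw q 0) (output_yaw q 1) (output_yaw q 2))"
    unfolding quartic_def
    by (intro Ck_on_add Ck_on_diff Ck_on_mult Ck_on_power Ck_on_const Ck_on_output_jets open_UNIV)
  then show ?thesis
    unfolding flat_domain_def
    by (intro open_Collect_neq) (simp_all add: continuous_on_const)
qed

lemma smooth_flat_parametrization: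
  assumes "g \<noteq> 0" and "g \<noteq> - 1"
  shows "smooth_on (flat_domain g b2) (flat_state g b2)"
    and "smooth_on (flat_domain g b2) (flat_input g c2 b1 b2 b3)"
proof -
  let ?S = "flat_domain g b2"
  note S = open_flat_domain
  have reg: "coef_det g b2 (output_yaw q) \<noteq> 0" "residual g b2 (output_yaw q) 2 0 \<noteq> 0" if "q \<in> ?S" for q
    using that chain_regular[OF assms, of b2 "output_yaw q"] by (simp_all add: flat_domain_def)
  note w = Ck_on_output_jets[OF S, of _ g b2]
  note sol = Ck_on_sol[where w = output_yaw and q = output_surge, OF S w reg]
  have \<theta>: "Ck_on n ?S (\<lambda>q. Poly_Mapping.lookup q 0 $ 2)" for n
    by (intro Ck_on_vec_nth Ck_on_lookup Ck_on_ident S)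
  have "\<forall>i. Ck_on n ?S (\<lambda>q. flat_state g b2 q $ i)" for n
    unfolding forall_6 flat_state_def Let_def vector_6
    by (intro conjI Ck_on_add Ck_on_diff Ck_on_mult Ck_on_sin Ck_on_cos sol w \<theta> S)
  then show "smooth_on ?S (flat_state g b2)"
    by (intro smooth_onI Ck_on_componentwise S) simp
  have "\<forall>i. Ck_on n ?S (\<lambda>q. flat_input g c2 b1 b2 b3 q $ i)" for n
    unfolding forall_2 flat_input_def Let_def vector_2
    by (intro conjI Ck_on_add Ck_on_diff Ck_on_mult Ck_on_const sol w S)
  then show "smooth_on ?S (flat_input g c2 b1 b2 b3)"
    by (intro smooth_onI Ck_on_componentwise S) simp
qed

text \<open>Bootstrapping: the right-hand side is as regular as the state and the smooth input, and
  the differential equation then gives the state one more order.\<close>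

lemma smooth_trajectory:
  assumes "trajectory_on I (vessel g c2 b1 b2 b3) x u"
  shows "smooth_on I x"
proof (rule smooth_onI)
  fix k
  have I: "open I" and u: "Ck_on n I u" for n
    using assms by (auto simp: trajectory_on_def smooth_on_def)
  have D: "(x has_vector_derivative vessel g c2 b1 b2 b3 t (x t) (u t)) (at t)" if "t \<in> I" for t
    using assms that by (simp add: trajectory_on_def)
  show "Ck_on k I x"
  proof (induction k)
    case 0
    have "continuous (at t) x" if "t \<in> I" for t
      using D[OF that] by (rule has_vector_derivative_continuous)
    then show ?case by (simp add: continuous_at_imp_continuous_on)
  next
    case (Suc k)
    have "\<forall>i. Ck_on k I (\<lambda>t. vessel g c2 b1 b2 b3 t (x t) (u t) $ i)"
      unfolding forall_6 vessel_nth
      by (intro conjI Ck_on_add Ck_on_diff Ck_on_mult Ck_on_const Ck_on_uminus Ck_on_sin Ck_on_cos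
          Ck_on_vec_nth Suc u I)
    then show ?case
      by (intro Ck_on_curve_SucI[OF I D] Ck_on_componentwise I) simp_all
  qed
qed

text \<open>The prolonged system is bypassed: the chain is evaluated directly on a trajectory of the
  vessel, where the jets of r and u are genuine derivatives.\<close>

lemma flat_parametrization:
  assumes g: "g \<noteq> 0" "g \<noteq> - 1" and traj: "trajectory_on I (vessel g c2 b1 b2 b3) x u"
    and reg: "\<And>t. t \<in> I \<Longrightarrow> (t, x t, curve_jet 1 u t) \<in> vessel_regular g c2 b1 b2 b3"
    and "t \<in> I"
  defines "y \<equiv> \<lambda>t. vessel_output g c2 b2 b3 (t, x t, curve_jet 1 u t)"
  shows "curve_jet 6 y t \<in> flat_domain g b2"
    and "x t = flat_state g b2 (curve_jet 6 y t)"
    and "u t = flat_input g c2 b1 b2 b3 (curve_jet 6 y t)"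
proof -
  have I: "open I" and u: "smooth_on I u"
    and D: "\<And>t. t \<in> I \<Longrightarrow> (x has_vector_derivative vessel g c2 b1 b2 b3 t (x t) (u t)) (at t)"
    using traj by (simp_all add: trajectory_on_def)
  have x: "smooth_on I x" by (rule smooth_trajectory[OF traj])
  have X: "((\<lambda>s. x s $ i) has_real_derivative vessel g c2 b1 b2 b3 t (x t) (u t) $ i) (at t)"
    if "t \<in> I" for t i
    using bounded_linear.has_vector_derivative[OF bounded_linear_vec_nth D[OF that]]
    by (simp add: has_real_derivative_iff_has_vector_derivative)
  have smooth_nth: "smooth_on I (\<lambda>s. x s $ i)" for i
    by (rule smooth_onI, rule Ck_on_vec_nth[OF I smooth_onD[OF x]])
  define w where "w t i = nth_vector_derivative i (\<lambda>s. x s $ 6) t" for t i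
  define \<mu> where "\<mu> t i = nth_vector_derivative i (\<lambda>s. x s $ 4) t" for t i
  have w: "((\<lambda>s. w s i) has_real_derivative w t (Suc i)) (at t)" if "t \<in> I" for t i
    using nth_vector_derivative_has_derivative[OF I smooth_nth that]
    by (simp add: w_def has_real_derivative_iff_has_vector_derivative)
  have \<mu>: "((\<lambda>s. \<mu> s i) has_real_derivative \<mu> t (Suc i)) (at t)" if "t \<in> I" for t i
    using nth_vector_derivative_has_derivative[OF I smooth_nth that]
    by (simp add: \<mu>_def has_real_derivative_iff_has_vector_derivative)
  have w0: "w t 0 = x t $ 6" and \<mu>0: "\<mu> t 0 = x t $ 4" for t
    by (simp_all add: w_def \<mu>_def nth_vector_derivative_0)
  have w1: "w t 1 = yaw_accel c2 b3 (x t) (u t)" if "t \<in> I" for t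
    using DERIV_unique[OF w[OF that, of 0, unfolded w0] X[OF that, of 6]]
    by (simp add: vessel_nth yaw_accel_def)
  have \<mu>1: "\<mu> t 1 = 1 / g * x t $ 5 * x t $ 6 - b1 * x t $ 4 + u t $ 1" if "t \<in> I" for t
    using DERIV_unique[OF \<mu>[OF that, of 0, unfolded \<mu>0] X[OF that, of 4]]
    by (simp add: vessel_nth)
  have w2: "w t 2 = yaw_jerk g c2 b1 b2 b3 (x t) (u t) (nth_vector_derivative 1 u t)" if "t \<in> I" for t
  proof -
    have "((\<lambda>s. u s $ 2) has_real_derivative nth_vector_derivative 1 u t $ 2) (at t)"
      using bounded_linear.has_vector_derivative[OF bounded_linear_vec_nth
          nth_vector_derivative_has_derivative[OF I u that, of 0]]
      by (simp add: has_real_derivative_iff_has_vector_derivative nth_vector_derivative_0)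
    from yaw_accel_has_derivative[OF X[OF that] this]
    have "((\<lambda>s. w s 1) has_real_derivative
        yaw_jerk g c2 b1 b2 b3 (x t) (u t) (nth_vector_derivative 1 u t)) (at t)"
      by (rule has_field_derivative_transform_within_open[OF _ I that]) (simp only: w1)
    with w[OF that, of 1] show ?thesis
      using DERIV_unique by (fastforce simp: numeral_2_eq_2)
  qed
  define F where "F k t = chain g b2 (w t) k (body_xi (x t $ 1) (x t $ 2) (x t $ 3))
      (body_eta (x t $ 1) (x t $ 2) (x t $ 3)) (x t $ 5) (\<mu> t)" for k t
  have F: "(F k has_real_derivative F (Suc k) t) (at t)" if "k < 5" "t \<in> I" for k t
  proof -
    note X' = X[OF that(2), of 1, unfolded vessel_nth] X[OF that(2), of 2, unfolded vessel_nth]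
      X[OF that(2), of 3, unfolded vessel_nth] X[OF that(2), of 5, unfolded vessel_nth]
    show ?thesis
      unfolding F_def
      by (rule chain_has_derivative)
        (simp_all only: w0 \<mu>0, (rule g that w \<mu> body_has_derivative X')+)
  qed
  \<comment> \<open>At order 0 the chain reads the yaw jet in its entries 0 and 1, where
    \<open>vessel_yaw_jet\<close> agrees with the true jet.\<close>
  have y_1: "y t $ 1 = F 0 t" if "t \<in> I" for t
    unfolding y_def F_def vessel_output_nth[OF g(2)]
    by (rule chain_cong)
      (auto simp: vessel_yaw_jet_def w0 w1[OF that, unfolded One_nat_def] lookup_curve_jet
        nth_vector_derivative_0 le_Suc_eq)
  have y_2: "y t $ 2 = x t $ 3" for t
    unfolding y_def vessel_output_nth[OF g(2)] ..
  have y: "smooth_on I y"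
    unfolding y_def
    by (intro smooth_onI Ck_on_vessel_output[OF g(2) I])
      (simp_all add: lookup_curve_jet nth_vector_derivative_0 smooth_onD x u)
  have surge: "nth_vector_derivative k y t $ 1 = F k t" if "k \<le> 4" for k
    by (rule nth_vector_derivative_nth_eq[OF I y _ _ _ \<open>t \<in> I\<close>, where n = 4])
      (use y_1 F that in auto)
  have yaw: "nth_vector_derivative k y t $ 2 = (if k = 0 then x t $ 3 else w t (k - 1))" for k
  proof (rule nth_vector_derivative_nth_eq[OF I y _ _ order_refl \<open>t \<in> I\<close>,
        where F = "\<lambda>k t. if k = 0 then x t $ 3 else w t (k - 1)"])
    show "((\<lambda>t. if j = 0 then x t $ 3 else w t (j - 1)) has_real_derivative
        (if Suc j = 0 then x t $ 3 else w t (Suc j - 1))) (at t)" if "t \<in> I" for j t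
      using X[OF that, of 3] w[OF that, of "j - 1"] by (cases "j = 0") (simp_all add: vessel_nth w0)
  qed (simp add: y_2)
  \<comment> \<open>Order 6 suffices: the second output then supplies r up to order 5, the highest
    that the chain of order 4 reads.\<close>
  define q where "q = curve_jet 6 y t"
  have q2: "output_yaw q i = w t i" if "i \<le> 5" for i
    using that by (simp add: q_def output_yaw_def lookup_curve_jet yaw)
  have q2_0: "Poly_Mapping.lookup q 0 $ 2 = x t $ 3"
    by (simp add: q_def lookup_curve_jet yaw)
  have q1: "output_surge q k = chain g b2 (output_yaw q) k (body_xi (x t $ 1) (x t $ 2) (x t $ 3))
      (body_eta (x t $ 1) (x t $ 2) (x t $ 3)) (x t $ 5) (\<mu> t)" if "k \<le> 4" for k
  proof -
    have "output_surge q k = F k t"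
      using that by (simp add: q_def output_surge_def lookup_curve_jet surge)
    also have "\<dots> = chain g b2 (output_yaw q) k (body_xi (x t $ 1) (x t $ 2) (x t $ 3))
      (body_eta (x t $ 1) (x t $ 2) (x t $ 3)) (x t $ 5) (\<mu> t)"
      unfolding F_def by (rule chain_cong) (use that q2 in auto)
    finally show ?thesis .
  qed
  \<comment> \<open>The regular set uses the total derivative of the second input with a bar; by
    \<open>w2\<close> its value along the trajectory is the second derivative of r, hence the third
    of the second output.\<close>
  have nz: "quartic g b2 (output_yaw q 0) (output_yaw q 1) (output_yaw q 2) \<noteq> 0"
    using reg[OF \<open>t \<in> I\<close>] w0 w1[OF \<open>t \<in> I\<close>] w2[OF \<open>t \<in> I\<close>]
    by (simp add: vessel_regular_eq[OF g] q2 lookup_curve_jet nth_vector_derivative_0)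
  then show "curve_jet 6 y t \<in> flat_domain g b2"
    by (simp add: flat_domain_def flip: q_def)
  note sol = chain_inject[OF chain_regular[OF g nz] q1]
  have "x t = flat_state g b2 q"
    by (simp add: vec_eq_iff forall_6 flat_state_def Let_def vector_6)
      (simp only: sol, simp add: q2_0 earth_body \<mu>0 q2 w0)
  then show "x t = flat_state g b2 (curve_jet 6 y t)" by (simp add: q_def)
  have "u t = flat_input g c2 b1 b2 b3 q"
    unfolding vec_eq_iff forall_2 flat_input_def Let_def vector_2
    by (simp only: sol) (simp only: q2 \<mu>0 \<mu>1[OF \<open>t \<in> I\<close>] w0 w1[OF \<open>t \<in> I\<close>], simp add: yaw_accel_def q2 w0)
  then show "u t = flat_input g c2 b1 b2 b3 (curve_jet 6 y t)" by (simp add: q_def)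
qed

lemma flat_output_on_vessel:
  assumes g: "g \<noteq> 0" "g \<noteq> - 1"
  shows "flat_output_on (vessel_regular g c2 b1 b2 b3) (vessel g c2 b1 b2 b3) (vessel_output g c2 b2 b3)"
  unfolding flat_output_on_def
proof (intro conjI exI)
  show open_reg: "open (vessel_regular g c2 b1 b2 b3)" by (rule open_vessel_regular[OF g])
  show "smooth_on (vessel_regular g c2 b1 b2 b3) (vessel_output g c2 b2 b3)"
  proof (rule smooth_onI)
    fix n
    have "Ck_on n (vessel_regular g c2 b1 b2 b3)
        (\<lambda>j. vessel_output g c2 b2 b3 (fst j, fst (snd j), snd (snd j)))"
      by (intro Ck_on_vessel_output[OF g(2)] open_reg Ck_on_lookup Ck_on_fst Ck_on_snd Ck_on_ident)
    then show "Ck_on n (vessel_regular g c2 b1 b2 b3) (vessel_output g c2 b2 b3)" by simp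
  qed
  have out: "vessel_output g c2 b2 b3 (t, X, U) = vessel_output g c2 b2 b3 (t, X, V)"
    if "Poly_Mapping.lookup U 0 = Poly_Mapping.lookup V 0" for t X U V
    unfolding vec_eq_iff forall_2 by (simp add: vessel_output_nth[OF g(2)] that)
  \<comment> \<open>The common order is 1 on account of the regular set, in which the first
    derivative of the input occurs.\<close>
  show "jet_order_le 1 (vessel_output g c2 b2 b3)"
    unfolding jet_order_le_def by (intro allI impI out) blast
  show "jet_order_le 1 (\<lambda>j. j \<in> vessel_regular g c2 b1 b2 b3)"
    by (simp add: jet_order_le_def vessel_regular_eq[OF g])
  show "open (flat_domain g b2)" "open (flat_domain g b2)" by (rule open_flat_domain)+
  show "smooth_on (flat_domain g b2) (flat_state g b2)"
    "smooth_on (flat_domain g b2) (flat_input g c2 b1 b2 b3)"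
    by (rule smooth_flat_parametrization[OF g])+
  show "\<forall>I x u. trajectory_on I (vessel g c2 b1 b2 b3) x u
      \<and> (\<forall>t\<in>I. (t, x t, curve_jet 1 u t) \<in> vessel_regular g c2 b1 b2 b3) \<longrightarrow>
     (let y = (\<lambda>t. vessel_output g c2 b2 b3 (t, x t, curve_jet 1 u t)) in
        \<forall>t\<in>I. curve_jet 6 y t \<in> flat_domain g b2 \<and> x t = flat_state g b2 (curve_jet 6 y t) \<and>
               curve_jet 6 y t \<in> flat_domain g b2 \<and> u t = flat_input g c2 b1 b2 b3 (curve_jet 6 y t))"
    unfolding Let_def by (intro allI impI ballI conjI flat_parametrization[OF g]) auto
qed

theorem mainTheorem2:
  fixes \<gamma>1 \<gamma>2 \<beta>1 \<beta>2 \<beta>3 :: real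
  assumes "\<gamma>1 \<noteq> 0" and "\<gamma>1 \<noteq> -1"
    and "\<beta>1 > 0" and "\<beta>2 > 0" and "\<beta>3 > 0"
    and "\<gamma>2 \<noteq> 0"
  shows
    \<comment> \<open>the time derivatives in question are functions of time, states and inputs\<close>
    "(\<forall>t X U.
        (let V = Poly_Mapping.single 0 (Poly_Mapping.lookup U 0);
             D = (\<lambda>k. (total_deriv (prolonged_vessel \<gamma>1 \<beta>1 \<beta>2) ^^ k) (prolonged_output \<gamma>1 \<beta>2))
         in (\<forall>k\<le>4. D k (t, X, U) $ 1 = D k (t, X, V) $ 1) \<and>
            (\<forall>k\<le>6. D k (t, X, U) $ 2 = D k (t, X, V) $ 2)))
     \<and>
     (\<forall>P. \<exists>J. (linearizing_map \<gamma>1 \<beta>1 \<beta>2 has_derivative (\<lambda>h. J *v h)) (at P) \<and>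
              det J = - Delta \<gamma>1 \<beta>2 (P$7) (P$8) (P$9))
     \<and>
     (\<forall>t X U. Delta \<gamma>1 \<beta>2 (X$6) (X$7) (X$8) \<noteq> 0 \<longrightarrow>
        static_feedback_linearizable_at (prolonged_vessel \<gamma>1 \<beta>1 \<beta>2) (t, X, U) \<and>
        (\<exists>N. (t, X, U) \<in> N \<and>
             generates_chains_on N (prolonged_vessel \<gamma>1 \<beta>1 \<beta>2) (prolonged_output \<gamma>1 \<beta>2)
               (\<lambda>c. if c = 1 then 4 else 6)))
     \<and>
     flat_output_on (vessel_regular \<gamma>1 \<gamma>2 \<beta>1 \<beta>2 \<beta>3) (vessel \<gamma>1 \<gamma>2 \<beta>1 \<beta>2 \<beta>3)
       (vessel_output \<gamma>1 \<gamma>2 \<beta>2 \<beta>3)"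
proof (intro conjI allI impI)
  note g = \<open>\<gamma>1 \<noteq> 0\<close> \<open>\<gamma>1 \<noteq> -1\<close>
  show "let V = Poly_Mapping.single 0 (Poly_Mapping.lookup U 0);
             D = (\<lambda>k. (total_deriv (prolonged_vessel \<gamma>1 \<beta>1 \<beta>2) ^^ k) (prolonged_output \<gamma>1 \<beta>2))
         in (\<forall>k\<le>4. D k (t, X, U) $ 1 = D k (t, X, V) $ 1) \<and>
            (\<forall>k\<le>6. D k (t, X, U) $ 2 = D k (t, X, V) $ 2)" for t X U
    unfolding Let_def
  proof (intro conjI allI impI)
    let ?V = "Poly_Mapping.single 0 (Poly_Mapping.lookup U 0)"
    fix k :: nat
    {
      assume "k \<le> 4"
      \<comment> \<open>For orders up to 4 the congruence compares only entry 0 of the input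
        sequences, where the two agree.\<close>
      moreover have "surge_chain \<gamma>1 \<beta>1 \<beta>2 k X (Poly_Mapping.lookup U)
          = surge_chain \<gamma>1 \<beta>1 \<beta>2 k X (Poly_Mapping.lookup ?V)"
        by (rule surge_chain_cong[OF \<open>k \<le> 4\<close>])
          (use \<open>k \<le> 4\<close> in \<open>auto simp: lookup_single when_def dest: order.trans\<close>)
      ultimately show "(total_deriv (prolonged_vessel \<gamma>1 \<beta>1 \<beta>2) ^^ k) (prolonged_output \<gamma>1 \<beta>2) (t, X, U) $ 1
        = (total_deriv (prolonged_vessel \<gamma>1 \<beta>1 \<beta>2) ^^ k) (prolonged_output \<gamma>1 \<beta>2) (t, X, ?V) $ 1"
        by (simp add: prolonged_output_derivs(1)[OF g(2)] output_jet_def)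
    next
      assume "k \<le> 6"
      moreover have "yaw_chain k X (Poly_Mapping.lookup U)
          = yaw_chain k X (Poly_Mapping.lookup ?V)"
        by (rule yaw_chain_cong) (use \<open>k \<le> 6\<close> in \<open>auto simp: lookup_single when_def dest: order.trans\<close>)
      ultimately show "(total_deriv (prolonged_vessel \<gamma>1 \<beta>1 \<beta>2) ^^ k) (prolonged_output \<gamma>1 \<beta>2) (t, X, U) $ 2
        = (total_deriv (prolonged_vessel \<gamma>1 \<beta>1 \<beta>2) ^^ k) (prolonged_output \<gamma>1 \<beta>2) (t, X, ?V) $ 2"
        by (simp add: prolonged_output_derivs(2)[OF g(2)])
    }
  qed
  show "\<exists>J. (linearizing_map \<gamma>1 \<beta>1 \<beta>2 has_derivative (\<lambda>h. J *v h)) (at P) \<and>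
              det J = - Delta \<gamma>1 \<beta>2 (P$7) (P$8) (P$9)" for P
    by (rule linearizing_map_jacobian[OF g(2)])
  fix t :: real and X :: "real^10" and U :: "real^2"
  assume "Delta \<gamma>1 \<beta>2 (X$6) (X$7) (X$8) \<noteq> 0"
  then have N: "(t, X, U) \<in> regular_set \<gamma>1 \<beta>2"
    by (simp add: regular_set_def Delta_nonzero_iff[OF g])
  then show "static_feedback_linearizable_at (prolonged_vessel \<gamma>1 \<beta>1 \<beta>2) (t, X, U)"
    unfolding static_feedback_linearizable_at_def
    using brunovsky_two_chains static_feedback_on_regular[OF g] by blast
  have "(\<lambda>c. if c = 1 then 4 else 6) = chain_order"
    by (simp add: fun_eq_iff chain_order_def)
  then show "\<exists>N. (t, X, U) \<in> N \<and>
      generates_chains_on N (prolonged_vessel \<gamma>1 \<beta>1 \<beta>2) (prolonged_output \<gamma>1 \<beta>2)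
        (\<lambda>c. if c = 1 then 4 else 6)"
    using N generates_chains_on_regular[OF g] by auto
next
  show "flat_output_on (vessel_regular \<gamma>1 \<gamma>2 \<beta>1 \<beta>2 \<beta>3) (vessel \<gamma>1 \<gamma>2 \<beta>1 \<beta>2 \<beta>3)
       (vessel_output \<gamma>1 \<gamma>2 \<beta>2 \<beta>3)"
    by (rule flat_output_on_vessel) (rule assms)+
qed

end
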